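(* Let $0<\gamma<n$ and $1<p<q<\infty$. Given a pair of weights $(w,\nu)$ on $\mathbb R^n$, suppose that for some $r>1$ there is a constant $C<\infty$ such that for all cubes $Q$ in $\mathbb R^n$, $$|Q|^{\gamma/n+1/q-1/p}\cdot\bigg(\frac{1}{|Q|}\int_Q w(x)^r\,dx\bigg)^{1/(rq)}\bigg(\frac{1}{|Q|}\int_Q \nu(x)^{-p'/p}\,dx\bigg)^{1/p'}\leq C.$$ If $\kappa=p/q$ and $w\in\Delta_2$, then the fractional integral operator $I_\gamma$ is bounded from $L^{p,\kappa}(\nu,w)$ into $\mathrm{BMO}(\mathbb R^n)$.
   Context: A weight on $\mathbb R^n$ is a nonnegative locally integrable function; for a weight $w$ and a measurable set $E$, $w(E)=\int_E w(x)\,dx$, and $|E|$ is Lebesgue measure. $p'=p/(p-1)$. All cubes have sides parallel to the coordinate axes; $Q(y,\ell)$ is the cube centered at $y$ with side length $\ell>0$, and for $\lambda>0$, $\lambda Q(y,\ell):=Q(y,\lambda\sqrt n\,\ell)$. $w\in\Delta_2$ means: there is a finite constant $C>0$ with $w(2Q)\le C\,w(Q)$ for every cube $Q$. Fractional integral operator: for $0<\gamma<n$, $$I_\gamma f(x)=\frac1{\zeta(\gamma)}\int_{\mathbb R^n}\frac{f(y)}{|x-y|^{n-\gamma}}\,dy,\qquad \zeta(\gamma)=\frac{\pi^{n/2}2^\gamma\Gamma(\gamma/2)}{\Gamma((n-\gamma)/2)}.$$ Weighted Morrey space: for $1<p<\infty$, $0\le\kappa<1$ and weights $w,\nu$, $L^{p,\kappa}(\nu,w)$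 is the set of $f\in L^p_{loc}(\nu)$ with $$\|f\|_{L^{p,\kappa}(\nu,w)}:=\sup_{Q}\bigg(\frac1{w(Q)^\kappa}\int_Q|f(x)|^p\nu(x)\,dx\bigg)^{1/p}<\infty,$$ the supremum being over all cubes $Q$ in $\mathbb R^n$. $\mathrm{BMO}(\mathbb R^n)$ is the set of $b\in L^1_{loc}(\mathbb R^n)$ with $\|b\|_*:=\sup_Q\frac1{|Q|}\int_Q|b(x)-b_Q|\,dx<\infty$, where $b_Q=\frac1{|Q|}\int_Qb(y)\,dy$ and the supremum is over all cubes $Q$; functions differing by a constant are identified, and $\|\cdot\|_*$ is the norm of $\mathrm{BMO}(\mathbb R^n)$. An operator $T$ is bounded from $X$ into $Y$ if there is a constant $C$ with $\|Tf\|_Y\le C\|f\|_X$ for all $f\in X$. *)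

theory Defs
  imports "HOL-Analysis.Analysis"
begin

text \<open>Functions are Lebesgue measurable; \<open>\<real>\<^sup>n\<close> is \<open>real ^ 'n\<close> with \<open>n = CARD('n)\<close>.\<close>

definition cube :: "real ^ 'n \<Rightarrow> real \<Rightarrow> (real ^ 'n) set" where
  "cube y l = cbox (\<chi> i. y $ i - l / 2) (\<chi> i. y $ i + l / 2)"

definition loc_integrable :: "(real ^ 'n \<Rightarrow> 'b::{banach, second_countable_topology}) \<Rightarrow> bool" where
  "loc_integrable f \<longleftrightarrow> (\<forall>K. compact K \<longrightarrow> set_integrable lebesgue K f)"

definition weight :: "(real ^ 'n \<Rightarrow> real) \<Rightarrow> bool" where
  "weight w \<longleftrightarrow> (\<forall>x. 0 \<le> w x) \<and> loc_integrable w"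

definition wmeasure :: "(real ^ 'n \<Rightarrow> real) \<Rightarrow> (real ^ 'n) set \<Rightarrow> ennreal" where
  "wmeasure w E = (\<integral>\<^sup>+x\<in>E. ennreal (w x) \<partial>lebesgue)"

text \<open>The dilate \<open>\<lambda>Q(y,l)\<close> is \<open>Q(y, \<lambda> \<surd>n l)\<close>, factor \<open>\<surd>n\<close> included.\<close>

definition doubling :: "(real ^ 'n \<Rightarrow> real) \<Rightarrow> bool" where
  "doubling w \<longleftrightarrow> (\<exists>C::real. C > 0 \<and> (\<forall>y l. l > 0 \<longrightarrow>
     wmeasure w (cube y (2 * sqrt (real CARD('n)) * l)) \<le> ennreal C * wmeasure w (cube y l)))"

text \<open>Powers with exponent \<open>a \<ge> 0\<close> on \<open>[0,\<infinity>]\<close>, with \<open>t\<^sup>0 = 1\<close> and \<open>\<infinity>\<^sup>a = \<infinity>\<close> for \<open>a > 0\<close>.\<close>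

definition epow :: "ennreal \<Rightarrow> real \<Rightarrow> ennreal" where
  "epow t a = (if a = 0 then 1 else if t = \<infinity> then \<infinity> else ennreal (enn2real t powr a))"

definition emean :: "(real ^ 'n) set \<Rightarrow> (real ^ 'n \<Rightarrow> ennreal) \<Rightarrow> ennreal" where
  "emean Q g = (\<integral>\<^sup>+x\<in>Q. g x \<partial>lebesgue) / emeasure lebesgue Q"

text \<open>The negative power \<open>\<nu>\<^sup>-\<^sup>a\<close> for \<open>a > 0\<close>; it is \<open>\<infinity>\<close> where \<open>\<nu> = 0\<close> (\<open>powr\<close> with a negative
  exponent would give \<open>0\<close> there). In a product \<open>\<dots> * epow (emean Q (w\<^sup>r)) s * epow (emean Q (\<nu>\<^sup>-\<^sup>a)) t \<le> C\<close> the
  convention \<open>0 * \<infinity> = 0\<close> would let \<open>w = \<nu> = 0\<close> pass; requiring \<open>emean Q (\<nu>\<^sup>-\<^sup>a) < \<infinity>\<close> as well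
  excludes this, and is automatic if \<open>w\<close> has positive integral over \<open>Q\<close>.\<close>

definition neg_power :: "(real ^ 'n \<Rightarrow> real) \<Rightarrow> real \<Rightarrow> real ^ 'n \<Rightarrow> ennreal" where
  "neg_power \<nu> a x = inverse (ennreal (\<nu> x powr a))"

definition conj_exp :: "real \<Rightarrow> real" where
  "conj_exp p = p / (p - 1)"

text \<open>In the quotient below, division on \<open>[0,\<infinity>]\<close> gives \<open>c / 0 = \<infinity>\<close> for \<open>c > 0\<close> and \<open>0 / 0 = 0\<close>.\<close>

definition morrey_norm ::
  "real \<Rightarrow> real \<Rightarrow> (real ^ 'n \<Rightarrow> real) \<Rightarrow> (real ^ 'n \<Rightarrow> real) \<Rightarrow> (real ^ 'n \<Rightarrow> complex) \<Rightarrow> ennreal" where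
  "morrey_norm p \<kappa> \<nu> w f =
     (SUP (y, l) \<in> UNIV \<times> {0<..}.
        epow ((\<integral>\<^sup>+x\<in>cube y l. ennreal (norm (f x) powr p * \<nu> x) \<partial>lebesgue)
              / epow (wmeasure w (cube y l)) \<kappa>) (1 / p))"

definition morrey_space ::
  "real \<Rightarrow> real \<Rightarrow> (real ^ 'n \<Rightarrow> real) \<Rightarrow> (real ^ 'n \<Rightarrow> real) \<Rightarrow> (real ^ 'n \<Rightarrow> complex) set" where
  "morrey_space p \<kappa> \<nu> w =
     {f. f \<in> borel_measurable lebesgue \<and>
         (\<forall>K. compact K \<longrightarrow> (\<integral>\<^sup>+x\<in>K. ennreal (norm (f x) powr p * \<nu> x) \<partial>lebesgue) < \<infinity>) \<and>
         morrey_norm p \<kappa> \<nu> w f < \<infinity>}"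

definition mean :: "(real ^ 'n) set \<Rightarrow> (real ^ 'n \<Rightarrow> complex) \<Rightarrow> complex" where
  "mean Q b = (1 / measure lebesgue Q) *\<^sub>R (LINT x:Q|lebesgue. b x)"

definition bmo_norm :: "(real ^ 'n \<Rightarrow> complex) \<Rightarrow> ennreal" where
  "bmo_norm b = (SUP (y, l) \<in> UNIV \<times> {0<..}.
     emean (cube y l) (\<lambda>x. ennreal (norm (b x - mean (cube y l) b))))"

definition bmo :: "(real ^ 'n \<Rightarrow> complex) set" where
  "bmo = {b. loc_integrable b \<and> bmo_norm b < \<infinity>}"

definition riesz_const :: "nat \<Rightarrow> real \<Rightarrow> real" where
  "riesz_const n \<gamma> =
     pi powr (real n / 2) * 2 powr \<gamma> * Gamma (\<gamma> / 2) / Gamma ((real n - \<gamma>) / 2)"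

definition riesz_kernel :: "real \<Rightarrow> real ^ 'n \<Rightarrow> real" where
  "riesz_kernel \<gamma> z = 1 / norm z powr (real CARD('n) - \<gamma>)"

definition riesz :: "real \<Rightarrow> (real ^ 'n \<Rightarrow> complex) \<Rightarrow> real ^ 'n \<Rightarrow> complex" where
  "riesz \<gamma> f x = (1 / riesz_const CARD('n) \<gamma>) *\<^sub>R
     (LINT y|lebesgue. riesz_kernel \<gamma> (x - y) *\<^sub>R f y)"

text \<open>For some \<open>f\<close> in a Morrey space the integral defining \<open>riesz \<gamma> f\<close> diverges at every point (for
  \<open>w = \<nu> = 1\<close> take \<open>f y = \<bar>y\<bar> powr -\<gamma>\<close>), and \<open>riesz \<gamma> f\<close> is then \<open>0\<close> by convention. As an element
  of BMO, whose members are functions modulo constants, the potential is given by its differences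
  \<open>b x - b x'\<close>, whose integrals do converge. The two lemmas say that this determines \<open>b\<close> up to an
  additive constant, and that \<open>b\<close> may be taken to be \<open>riesz \<gamma> f\<close> when the latter converges.\<close>

definition riesz_mod_const ::
  "real \<Rightarrow> (real ^ 'n \<Rightarrow> complex) \<Rightarrow> (real ^ 'n \<Rightarrow> complex) \<Rightarrow> bool" where
  "riesz_mod_const \<gamma> f b \<longleftrightarrow>
     (AE x in lebesgue. AE x' in lebesgue.
        integrable lebesgue (\<lambda>y. (riesz_kernel \<gamma> (x - y) - riesz_kernel \<gamma> (x' - y)) *\<^sub>R f y) \<and>
        b x - b x' = (1 / riesz_const CARD('n) \<gamma>) *\<^sub>R
          (LINT y|lebesgue. (riesz_kernel \<gamma> (x - y) - riesz_kernel \<gamma> (x' - y)) *\<^sub>R f y))"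

lemma riesz_mod_const_riesz:
  fixes f :: "real ^ 'n \<Rightarrow> complex"
  assumes "AE x in lebesgue. integrable lebesgue (\<lambda>y. riesz_kernel \<gamma> (x - y) *\<^sub>R f y)"
  shows "riesz_mod_const \<gamma> f (riesz \<gamma> f)"
proof -
  let ?I = "\<lambda>x. integrable lebesgue (\<lambda>y. riesz_kernel \<gamma> (x - y) *\<^sub>R f y)"
  have "integrable lebesgue (\<lambda>y. (riesz_kernel \<gamma> (x - y) - riesz_kernel \<gamma> (x' - y)) *\<^sub>R f y) \<and>
        riesz \<gamma> f x - riesz \<gamma> f x' = (1 / riesz_const CARD('n) \<gamma>) *\<^sub>R
          (LINT y|lebesgue. (riesz_kernel \<gamma> (x - y) - riesz_kernel \<gamma> (x' - y)) *\<^sub>R f y)"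
    if "?I x" "?I x'" for x x'
    using that
    by (simp add: riesz_def scaleR_diff_left Bochner_Integration.integral_diff
        flip: scaleR_diff_right)
  then show ?thesis
    unfolding riesz_mod_const_def using assms
    by (elim eventually_mono) (use assms in \<open>auto elim!: eventually_mono\<close>)
qed

lemma riesz_mod_const_unique:
  assumes "riesz_mod_const \<gamma> f b" "riesz_mod_const \<gamma> f b'"
  shows "\<exists>c. AE x in lebesgue. b x = b' x + c"
proof -
  have "AE x in lebesgue. AE x' in lebesgue. b x - b x' = b' x - b' x'"
    using assms unfolding riesz_mod_const_def
  proof eventually_elim
    case (elim x)
    then show ?case by eventually_elim simp
  qed
  moreover have "ae_filter (lebesgue :: (real ^ 'n) measure) \<noteq> bot"
    by (auto simp: trivial_limit_def eventually_ae_filter null_sets_def top.extremum_unique)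
  ultimately obtain x where x: "AE x' in lebesgue. b x - b x' = b' x - b' x'"
    using eventually_happens' by blast
  have "AE x' in lebesgue. b x' = b' x' + (b x - b' x)"
    using x by eventually_elim (simp add: algebra_simps)
  then show ?thesis by blast
qed

end

theory Submission
  imports Defs
begin

text \<open>
  Write \<open>n\<close> for the dimension, \<open>s = n - \<gamma>\<close>, and \<open>N\<close> for the Morrey norm of \<open>f\<close>. The weights can be
  eliminated at once. Hoelder's inequality gives
  \<open>\<integral>\<^sub>Q |f| \<le> (\<integral>\<^sub>Q |f|\<^sup>p \<nu>)\<^sup>1\<^sup>/\<^sup>p (\<integral>\<^sub>Q \<nu>\<^sup>-\<^sup>p\<^sup>'\<^sup>/\<^sup>p)\<^sup>1\<^sup>/\<^sup>p\<^sup>'\<close>, the first factor is at most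
  \<open>N w(Q)\<^sup>1\<^sup>/\<^sup>q\<close> because \<open>\<kappa> = p / q\<close>, and Jensen's inequality bounds \<open>w(Q)\<close> by the mean of \<open>w\<^sup>r\<close>.
  The two-weight condition then collapses the product to
  \<open>\<integral>\<^sub>Q |f| \<le> C N l\<^sup>s\<close> for every cube \<open>Q\<close> of side length \<open>l\<close> (\<open>morrey_space_L1_bound\<close>).

  It remains to show that the potential of a function with \<open>\<integral>\<^sub>Q |f| \<le> A l\<^sup>s\<close> for all cubes has BMO norm at
  most a constant times \<open>A\<close>. Let \<open>k\<close> be the Riesz kernel and \<open>Q\<close> a cube with centre \<open>y\<close> and side \<open>l\<close>.
  For \<open>x, x'\<close> in \<open>Q\<close> the integral of \<open>|k(x - z) - k(x' - z)| |f(z)|\<close> is split at \<open>|z - y| = \<surd>n l\<close>. The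
  far part is at most a constant times \<open>l \<integral> |z - y|\<^sup>-\<^sup>s\<^sup>-\<^sup>1 |f(z)| dz\<close> by the mean value theorem, hence
  at most a constant times \<open>A\<close> by summation over dyadic shells (\<open>nn_integral_far\<close>). The near part is at
  most \<open>u(x) + u(x')\<close>, where \<open>u\<close> is the potential of \<open>|f|\<close> restricted to the ball, and Tonelli's theorem
  bounds the mean of \<open>u\<close> over \<open>Q\<close> by a constant times \<open>A\<close> (\<open>nn_integral_near_potential\<close>). With \<open>x'\<close> a
  point at which \<open>u\<close> does not exceed its mean, \<open>b - b(x')\<close> has mean modulus over \<open>Q\<close> at most a constant
  times \<open>A\<close>, for any \<open>b\<close> whose differences are given by the kernel differences (\<open>riesz_mod_const_bmo\<close>).

  The same pointwise estimate shows that kernel differences are integrable against \<open>f\<close> for almost all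
  pairs of points, so such a \<open>b\<close> exists, and that \<open>\<integral> k(x - z) f(z) dz\<close> converges absolutely either for almost
  every \<open>x\<close> or for none. In the first case \<open>riesz \<gamma> f\<close> is such a \<open>b\<close>; in the second it is zero.
\<close>

section \<open>Powers on the extended half-line\<close>

lemma epow_ennreal: "0 \<le> x \<Longrightarrow> 0 < a \<Longrightarrow> epow (ennreal x) a = ennreal (x powr a)"
  by (simp add: epow_def)

lemma epow_top: "0 < a \<Longrightarrow> epow \<infinity> a = \<infinity>" "0 < a \<Longrightarrow> epow top a = \<infinity>"
  by (simp_all add: epow_def)

lemma epow_eq_0_iff: "0 < a \<Longrightarrow> epow t a = 0 \<longleftrightarrow> t = 0"
  by (cases t) (auto simp: epow_def)

lemma epow_mono:
  assumes "t \<le> u" "0 < a" shows "epow t a \<le> epow u a"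
  using assms by (cases t; cases u) (auto simp: epow_def top_unique intro!: powr_mono2)

lemma mult_epow_divide:
  assumes "0 < V" "0 < a" "a < 1"
  shows "ennreal V * epow (t / ennreal V) a = epow t a * ennreal (V powr (1 - a))"
proof (cases t)
  case (real x)
  have "V * (x / V) powr a = x powr a * V powr (1 - a)"
    using assms real by (simp add: powr_divide powr_diff)
  then show ?thesis
    using assms real
    by (simp add: divide_ennreal epow_ennreal ennreal_mult'[symmetric])
next
  case top
  then show ?thesis
    using assms by (simp add: epow_top ennreal_top_divide ennreal_mult_top ennreal_top_mult)
qed

lemma epow_mult_real:
  assumes "0 \<le> V" "0 < a" "t < \<infinity>"
  shows "epow (ennreal V * t) a = ennreal (V powr a) * epow t a"
  using assms by (cases t) (auto simp: epow_ennreal ennreal_mult'[symmetric] powr_mult)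

lemma epow_epow: "0 < a \<Longrightarrow> 0 < b \<Longrightarrow> epow (epow t a) b = epow t (a * b)"
  by (cases t) (auto simp: epow_def powr_powr)

section \<open>Hoelder's inequality\<close>

text \<open>The right-hand side is a product in \<open>[0,\<infinity>]\<close>. The convention \<open>0 \<cdot> \<infinity> = 0\<close> does no harm there,
  since the left-hand side vanishes as soon as one of the two integrals does.\<close>

lemma nn_integral_Holder:
  fixes F G :: "'a \<Rightarrow> real"
  assumes [measurable]: "F \<in> borel_measurable M" "G \<in> borel_measurable M"
    and nonneg: "\<And>x. 0 \<le> F x" "\<And>x. 0 \<le> G x"
    and pq: "1 < p" "1 < q" "1 / p + 1 / q = 1"
  shows "(\<integral>\<^sup>+x. ennreal (F x * G x) \<partial>M) \<le>
    epow (\<integral>\<^sup>+x. ennreal (F x powr p) \<partial>M) (1 / p) * epow (\<integral>\<^sup>+x. ennreal (G x powr q) \<partial>M) (1 / q)"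
    (is "?L \<le> epow ?I (1 / p) * epow ?J (1 / q)")
proof -
  consider "?I = 0" | "?J = 0" | "?I \<noteq> 0" "?J \<noteq> 0" "?I = \<infinity> \<or> ?J = \<infinity>"
    | "?I \<noteq> 0" "?J \<noteq> 0" "?I < \<infinity>" "?J < \<infinity>"
    by (cases "?I = \<infinity> \<or> ?J = \<infinity>") (auto simp: less_top[symmetric])
  then show ?thesis
  proof cases
    case 1
    then have "AE x in M. F x powr p \<le> 0"
      by (simp add: nn_integral_0_iff_AE ennreal_eq_0_iff)
    then have "AE x in M. ennreal (F x * G x) = 0"
      by eventually_elim (use pq in auto)
    then have "?L = 0" by (simp add: nn_integral_0_iff_AE)
    then show ?thesis by simp
  next
    case 2
    then have "AE x in M. G x powr q \<le> 0"
      by (simp add: nn_integral_0_iff_AE ennreal_eq_0_iff)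
    then have "AE x in M. ennreal (F x * G x) = 0"
      by eventually_elim (use pq in auto)
    then have "?L = 0" by (simp add: nn_integral_0_iff_AE)
    then show ?thesis by simp
  next
    case 3
    then have "epow ?I (1 / p) * epow ?J (1 / q) = \<infinity>"
      using pq epow_eq_0_iff[of "1/p" ?I] epow_eq_0_iff[of "1/q" ?J]
      by (auto simp: epow_top ennreal_mult_eq_top_iff)
    then show ?thesis by (simp only: infinity_ennreal_def top_greatest)
  next
    case 4
    define \<alpha> where "\<alpha> = enn2real ?I"
    define \<beta> where "\<beta> = enn2real ?J"
    have I: "?I = ennreal \<alpha>" "0 < \<alpha>" and J: "?J = ennreal \<beta>" "0 < \<beta>"
      using 4 by (auto simp: \<alpha>_def \<beta>_def less_top enn2real_positive_iff zero_less_iff_neq_zero)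
    define a where "a = \<alpha> powr (1 / p)"
    define b where "b = \<beta> powr (1 / q)"
    have ab: "0 < a" "0 < b" "a powr p = \<alpha>" "b powr q = \<beta>"
      using I J pq by (auto simp: a_def b_def powr_powr)
    \<comment> \<open>Young's inequality for the functions normalised to have norm one.\<close>
    have "F x * G x \<le> a * b * (F x powr p / (p * \<alpha>) + G x powr q / (q * \<beta>))" for x
    proof -
      have "F x / a * (G x / b) \<le> (F x / a) powr p / p + (G x / b) powr q / q"
        using pq nonneg ab by (intro Youngs_inequality) auto
      also have "\<dots> = F x powr p / (p * \<alpha>) + G x powr q / (q * \<beta>)"
        using nonneg ab by (simp add: powr_divide mult.commute)
      finally show ?thesis
        using ab by (simp add: field_simps)
    qed
    then have "?L \<le> (\<integral>\<^sup>+x. ennreal (a * b / (p * \<alpha>)) * ennreal (F x powr p)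
        + ennreal (a * b / (q * \<beta>)) * ennreal (G x powr q) \<partial>M)"
      using ab pq I J
      by (intro nn_integral_mono)
        (simp add: ennreal_mult'[symmetric] ennreal_plus[symmetric] distrib_left algebra_simps
          del: ennreal_plus)
    also have "\<dots> = ennreal (a * b / (p * \<alpha>)) * ?I + ennreal (a * b / (q * \<beta>)) * ?J"
      by (simp add: nn_integral_add nn_integral_cmult)
    also have "\<dots> = ennreal (a * b / (p * \<alpha>) * \<alpha> + a * b / (q * \<beta>) * \<beta>)"
      using ab pq I J by (simp add: ennreal_mult'[symmetric])
    also have "a * b / (p * \<alpha>) * \<alpha> + a * b / (q * \<beta>) * \<beta> = a * b * (1 / p + 1 / q)"
      using I J by (simp add: field_simps)
    also have "ennreal (a * b * (1 / p + 1 / q)) = epow ?I (1 / p) * epow ?J (1 / q)"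
      using I J pq ab by (simp add: epow_ennreal a_def b_def ennreal_mult')
    finally show ?thesis .
  qed
qed

section \<open>Cubes\<close>

lemma mem_cube: "x \<in> cube y l \<longleftrightarrow> (\<forall>i. \<bar>x $ i - y $ i\<bar> \<le> l / 2)"
proof -
  have "a - l / 2 \<le> b \<and> b \<le> a + l / 2 \<longleftrightarrow> \<bar>b - a\<bar> \<le> l / 2" for a b :: real
    by linarith
  then show ?thesis unfolding cube_def mem_box_cart by simp
qed

lemma sets_cube [measurable, simp]: "cube y l \<in> sets borel" "cube y l \<in> sets lebesgue"
  by (simp_all add: cube_def)

lemma measure_cube:
  fixes y :: "real ^ 'n"
  assumes "0 \<le> l"
  shows "measure lborel (cube y l) = l ^ CARD('n)"
proof -
  have "y \<in> cube y l" using assms by (simp add: mem_cube)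
  then have "cbox (\<chi> i. y $ i - l / 2) (\<chi> i. y $ i + l / 2) \<noteq> {}"
    unfolding cube_def by blast
  from content_cbox_cart[OF this] show ?thesis by (simp add: cube_def)
qed

lemma emeasure_cube:
  fixes y :: "real ^ 'n"
  assumes "0 \<le> l"
  shows "emeasure lborel (cube y l) = ennreal (l ^ CARD('n))"
proof -
  have "emeasure lborel (cube y l) \<noteq> \<infinity>"
    using emeasure_lborel_cbox_finite by (simp add: cube_def less_top)
  then show ?thesis
    using measure_cube[OF assms, of y] by (simp add: emeasure_eq_ennreal_measure)
qed

lemma norm_le_if_mem_cube:
  fixes y :: "real ^ 'n"
  assumes "x \<in> cube y l"
  shows "norm (x - y) \<le> sqrt (real CARD('n)) * l / 2"
proof -
  have "0 \<le> \<bar>x $ i - y $ i\<bar>" "\<bar>x $ i - y $ i\<bar> \<le> l / 2" for i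
    using assms by (auto simp: mem_cube)
  from order_trans[OF this] have l: "0 \<le> l" by simp
  have "norm (x - y) = sqrt (\<Sum>i\<in>UNIV. \<bar>x $ i - y $ i\<bar>\<^sup>2)"
    by (simp add: norm_vec_def L2_set_def)
  also have "\<dots> \<le> sqrt (\<Sum>i\<in>(UNIV::'n set). (l / 2)\<^sup>2)"
    using assms by (intro real_sqrt_le_mono sum_mono power_mono) (auto simp: mem_cube)
  also have "\<dots> = sqrt (real CARD('n)) * l / 2"
    using l by (simp add: real_sqrt_mult)
  finally show ?thesis .
qed

lemma mem_cube_if_norm_le: "norm (x - y) \<le> l / 2 \<Longrightarrow> x \<in> cube y l"
  unfolding mem_cube using component_le_norm_cart[of "x - y"]
  by (metis order_trans vector_minus_component)

lemma compact_cube [simp]: "compact (cube y l)"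
  by (simp add: cube_def)

lemma compact_subset_cube:
  fixes K :: "(real ^ 'n) set"
  assumes "compact K"
  obtains l where "0 < l" "K \<subseteq> cube 0 l"
proof -
  obtain r where r: "0 < r" "\<And>x. x \<in> K \<Longrightarrow> norm x \<le> r"
    using compact_imp_bounded[OF assms] by (auto simp: bounded_pos)
  show thesis
    using r by (intro that[of "2 * r"] subsetI mem_cube_if_norm_le) auto
qed

lemma emean_cube_mult:
  fixes y :: "real ^ 'n"
  assumes "0 < l"
  shows "(\<integral>\<^sup>+x\<in>cube y l. g x \<partial>lebesgue) = ennreal (l ^ CARD('n)) * emean (cube y l) g"
  using assms unfolding emean_def
  by (simp add: emeasure_cube ennreal_times_divide mult.commute[of "ennreal _"] ennreal_mult_divide_eq)

section \<open>From the weighted to the unweighted Morrey condition\<close>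

lemma loc_integrable_measurable:
  fixes w :: "real ^ 'n \<Rightarrow> real"
  assumes "loc_integrable w"
  shows "w \<in> borel_measurable lebesgue"
proof (rule borel_measurable_LIMSEQ_real)
  fix x :: "real ^ 'n"
  obtain N :: nat where N: "norm x \<le> real N" using real_arch_simple by blast
  have "\<forall>\<^sub>F m in sequentially. indicator (cball 0 (real m)) x *\<^sub>R w x = w x"
    using eventually_ge_at_top[of N] by eventually_elim (use N in \<open>auto simp: indicator_def\<close>)
  then show "(\<lambda>m. indicator (cball 0 (real m)) x *\<^sub>R w x) \<longlonglongrightarrow> w x"
    by (rule tendsto_eventually)
next
  fix m :: nat
  have "set_integrable lebesgue (cball 0 (real m)) w"
    using assms compact_cball unfolding loc_integrable_def by blast
  then show "(\<lambda>x. indicator (cball 0 (real m)) x *\<^sub>R w x) \<in> borel_measurable lebesgue"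
    unfolding set_integrable_def by (rule borel_measurable_integrable)
qed

lemma wmeasure_finite:
  fixes w :: "real ^ 'n \<Rightarrow> real"
  assumes "weight w" "compact K"
  shows "wmeasure w K < \<infinity>"
proof -
  have "set_integrable lebesgue K w" and nn: "\<And>x. 0 \<le> w x"
    using assms by (auto simp: weight_def loc_integrable_def)
  then have "(\<integral>\<^sup>+x. ennreal (norm (indicator K x *\<^sub>R w x)) \<partial>lebesgue) < \<infinity>"
    by (simp add: set_integrable_def integrable_iff_bounded)
  also have "(\<integral>\<^sup>+x. ennreal (norm (indicator K x *\<^sub>R w x)) \<partial>lebesgue) = wmeasure w K"
    unfolding wmeasure_def by (intro nn_integral_cong) (auto simp: indicator_def nn)
  finally show ?thesis .
qed

text \<open>Jensen's inequality \<open>w(Q) / |Q| \<le> (|Q|\<^sup>-\<^sup>1 \<integral>\<^sub>Q w\<^sup>r)\<^sup>1\<^sup>/\<^sup>r\<close>, obtained from Hoelder's inequality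
  with the constant function \<open>1\<close> as second factor.\<close>

lemma wmeasure_le_power_mean:
  fixes w :: "real ^ 'n \<Rightarrow> real"
  assumes [measurable]: "w \<in> borel_measurable lebesgue"
    and nonneg: "\<And>x. 0 \<le> w x" and "1 < r" "0 < l"
  shows "wmeasure w (cube y l) \<le>
    ennreal (l ^ CARD('n)) * epow (emean (cube y l) (\<lambda>x. ennreal (w x powr r))) (1 / r)"
proof -
  let ?Q = "cube y l"
  define q where "q = r / (r - 1)"
  have q: "1 < q" "1 / r + 1 / q = 1" "1 / q = 1 - 1 / r"
    using \<open>1 < r\<close> by (auto simp: q_def field_simps)
  have V: "0 < l ^ CARD('n)" using \<open>0 < l\<close> by simp
  have "wmeasure w ?Q = (\<integral>\<^sup>+x. ennreal ((indicator ?Q x * w x) * indicator ?Q x) \<partial>lebesgue)"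
    unfolding wmeasure_def by (intro nn_integral_cong) (auto simp: indicator_def)
  also have "\<dots> \<le> epow (\<integral>\<^sup>+x. ennreal ((indicator ?Q x * w x) powr r) \<partial>lebesgue) (1 / r)
      * epow (\<integral>\<^sup>+x. ennreal (indicator ?Q x powr q) \<partial>lebesgue) (1 / q)"
    using q \<open>1 < r\<close> nonneg by (intro nn_integral_Holder) auto
  also have "(\<integral>\<^sup>+x. ennreal (indicator ?Q x powr q) \<partial>lebesgue) = (\<integral>\<^sup>+x. indicator ?Q x \<partial>lebesgue)"
    by (intro nn_integral_cong) (auto simp: indicator_def)
  also have "\<dots> = ennreal (l ^ CARD('n))"
    using \<open>0 < l\<close> by (simp add: emeasure_cube)
  also have "(\<integral>\<^sup>+x. ennreal ((indicator ?Q x * w x) powr r) \<partial>lebesgue)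
      = (\<integral>\<^sup>+x\<in>?Q. ennreal (w x powr r) \<partial>lebesgue)"
    by (intro nn_integral_cong) (auto simp: indicator_def)
  finally show ?thesis
    using mult_epow_divide[OF V, of "1 / r"] V q \<open>1 < r\<close> \<open>0 < l\<close>
    by (simp add: emean_def emeasure_cube epow_ennreal)
qed

text \<open>Hoelder's inequality for the factorisation \<open>|f| = (|f| \<nu>\<^sup>1\<^sup>/\<^sup>p) \<nu>\<^sup>-\<^sup>1\<^sup>/\<^sup>p\<close>.\<close>

lemma nn_integral_cube_le_weighted:
  fixes f :: "real ^ 'n \<Rightarrow> complex"
  assumes [measurable]: "f \<in> borel_measurable lebesgue" "\<nu> \<in> borel_measurable lebesgue"
    and nonneg: "\<And>x. 0 \<le> \<nu> x" and "1 < p" "0 < l"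
    and fin: "emean (cube y l) (neg_power \<nu> (conj_exp p / p)) < \<infinity>"
  shows "(\<integral>\<^sup>+x\<in>cube y l. ennreal (norm (f x)) \<partial>lebesgue) \<le>
    epow (\<integral>\<^sup>+x\<in>cube y l. ennreal (norm (f x) powr p * \<nu> x) \<partial>lebesgue) (1 / p)
    * epow (\<integral>\<^sup>+x\<in>cube y l. neg_power \<nu> (conj_exp p / p) x \<partial>lebesgue) (1 / conj_exp p)"
proof -
  let ?Q = "cube y l"
  define q where "q = conj_exp p"
  have q: "1 < q" "1 / p + 1 / q = 1"
    using \<open>1 < p\<close> by (auto simp: q_def conj_exp_def field_simps)
  have [measurable]: "neg_power \<nu> (q / p) \<in> borel_measurable lebesgue"
    unfolding neg_power_def by measurable
  have "(\<integral>\<^sup>+x\<in>?Q. neg_power \<nu> (q / p) x \<partial>lebesgue) \<noteq> \<infinity>"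
    using fin \<open>0 < l\<close> unfolding emean_def q_def[symmetric]
    by (auto simp: emeasure_cube ennreal_top_divide)
  then have "AE x in lebesgue. neg_power \<nu> (q / p) x * indicator ?Q x \<noteq> \<infinity>"
    by (intro nn_integral_noteq_infinite) measurable
  \<comment> \<open>Finiteness of the second integral makes the weight positive almost everywhere on the cube.\<close>
  then have pos: "AE x in lebesgue. x \<in> ?Q \<longrightarrow> 0 < \<nu> x"
  proof eventually_elim
    case (elim x)
    show ?case
    proof
      assume "x \<in> ?Q"
      then have "\<nu> x \<noteq> 0" using elim by (auto simp: neg_power_def)
      then show "0 < \<nu> x" using nonneg[of x] by simp
    qed
  qed
  define F where "F x = indicator ?Q x * (norm (f x) * \<nu> x powr (1 / p))" for x
  define G where "G x = indicator ?Q x * \<nu> x powr (- 1 / p)" for x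
  have [measurable]: "F \<in> borel_measurable lebesgue" "G \<in> borel_measurable lebesgue"
    unfolding F_def G_def by measurable
  have "(\<integral>\<^sup>+x\<in>?Q. ennreal (norm (f x)) \<partial>lebesgue) = (\<integral>\<^sup>+x. ennreal (F x * G x) \<partial>lebesgue)"
  proof (intro nn_integral_cong_AE, use pos in eventually_elim)
    case (elim x)
    then show ?case
      by (auto simp: F_def G_def indicator_def powr_add[symmetric])
  qed
  also have "\<dots> \<le> epow (\<integral>\<^sup>+x. ennreal (F x powr p) \<partial>lebesgue) (1 / p)
      * epow (\<integral>\<^sup>+x. ennreal (G x powr q) \<partial>lebesgue) (1 / q)"
    using q \<open>1 < p\<close> by (intro nn_integral_Holder) (auto simp: F_def G_def)
  also have "(\<integral>\<^sup>+x. ennreal (F x powr p) \<partial>lebesgue)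
      = (\<integral>\<^sup>+x\<in>?Q. ennreal (norm (f x) powr p * \<nu> x) \<partial>lebesgue)"
    using \<open>1 < p\<close> nonneg
    by (intro nn_integral_cong) (auto simp: F_def indicator_def powr_mult powr_powr)
  also have "(\<integral>\<^sup>+x. ennreal (G x powr q) \<partial>lebesgue) = (\<integral>\<^sup>+x\<in>?Q. neg_power \<nu> (q / p) x \<partial>lebesgue)"
  proof (intro nn_integral_cong_AE, use pos in eventually_elim)
    case (elim x)
    have "(\<nu> x powr (- 1 / p)) powr q = inverse (\<nu> x powr (q / p))"
      by (simp only: powr_powr powr_minus[symmetric]) simp
    with elim show ?case
      by (auto simp: G_def neg_power_def indicator_def inverse_ennreal)
  qed
  finally show ?thesis unfolding q_def .
qed

text \<open>The definition of the Morrey norm, cleared of its quotient. If \<open>w(Q) = 0\<close>, finiteness of the norm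
  forces the weighted integral over \<open>Q\<close> to vanish.\<close>

lemma morrey_norm_cube:
  assumes "f \<in> morrey_space p \<kappa> \<nu> w" "0 < l" "0 < p" "0 < \<kappa>"
    and "wmeasure w (cube y l) < \<infinity>"
  shows "epow (\<integral>\<^sup>+x\<in>cube y l. ennreal (norm (f x) powr p * \<nu> x) \<partial>lebesgue) (1 / p)
    \<le> morrey_norm p \<kappa> \<nu> w f * epow (wmeasure w (cube y l)) (\<kappa> / p)"
proof -
  let ?I = "\<integral>\<^sup>+x\<in>cube y l. ennreal (norm (f x) powr p * \<nu> x) \<partial>lebesgue"
  let ?W = "wmeasure w (cube y l)"
  let ?N = "morrey_norm p \<kappa> \<nu> w f"
  have N: "?N < \<infinity>" and I: "?I < \<infinity>"
    using assms(1) by (auto simp: morrey_space_def)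
  have le: "epow (?I / epow ?W \<kappa>) (1 / p) \<le> ?N"
    unfolding morrey_norm_def using \<open>0 < l\<close> by (intro SUP_upper2[of "(y, l)"]) auto
  obtain W where W: "?W = ennreal W" "0 \<le> W"
    using assms(5) by (cases ?W) auto
  obtain I' where I': "?I = ennreal I'" "0 \<le> I'"
    using I by (cases ?I) auto
  show ?thesis
  proof (cases "W = 0")
    case True
    then have e0: "epow ?W \<kappa> = 0" using W \<open>0 < \<kappa>\<close> by (simp add: epow_eq_0_iff)
    have "I' = 0"
    proof (rule ccontr)
      assume "I' \<noteq> 0"
      then have "?I / epow ?W \<kappa> = \<infinity>"
        using e0 I' by (simp add: ennreal_divide_zero)
      then have "epow (?I / epow ?W \<kappa>) (1 / p) = \<infinity>"
        using \<open>0 < p\<close> by (simp add: epow_top)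
      then show False using le N by (simp add: top_unique)
    qed
    then show ?thesis using I' \<open>0 < p\<close> by (simp add: epow_def)
  next
    case False
    then have "0 < W" using W by simp
    have "epow ?I (1 / p) = epow (?I / epow ?W \<kappa>) (1 / p) * epow ?W (\<kappa> / p)"
      using W I' \<open>0 < W\<close> \<open>0 < \<kappa>\<close> \<open>0 < p\<close>
      by (simp add: epow_ennreal divide_ennreal ennreal_mult'[symmetric] powr_divide powr_powr)
    also have "\<dots> \<le> ?N * epow ?W (\<kappa> / p)"
      by (intro mult_right_mono le) auto
    finally show ?thesis .
  qed
qed

text \<open>The two-weight condition turns the weighted Morrey bound into the unweighted bound
  \<open>\<integral>\<^sub>Q |f| \<le> C N |Q|\<^sup>1\<^sup>-\<^sup>\<gamma>\<^sup>/\<^sup>n\<close>, where \<open>N\<close> is the Morrey norm. The choice \<open>\<kappa> = p / q\<close> makes the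
  power of \<open>w(Q)\<close> equal to \<open>1 / q\<close>, so that Jensen's inequality produces the factor of the condition.\<close>

lemma morrey_space_L1_bound:
  fixes w \<nu> :: "real ^ 'n \<Rightarrow> real" and f :: "real ^ 'n \<Rightarrow> complex"
  assumes pq: "1 < p" "p < q" and r: "1 < r"
    and w: "weight w" and \<nu>: "weight \<nu>" and "0 < l"
    and fin: "emean (cube y l) (neg_power \<nu> (conj_exp p / p)) < \<infinity>"
    and C: "ennreal (measure lebesgue (cube y l) powr (\<gamma> / real CARD('n) + 1 / q - 1 / p))
             * epow (emean (cube y l) (\<lambda>x. ennreal (w x powr r))) (1 / (r * q))
             * epow (emean (cube y l) (neg_power \<nu> (conj_exp p / p))) (1 / conj_exp p)
           \<le> ennreal C"
    and f: "f \<in> morrey_space p (p / q) \<nu> w"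
  shows "(\<integral>\<^sup>+x\<in>cube y l. ennreal (norm (f x)) \<partial>lebesgue)
    \<le> ennreal C * morrey_norm p (p / q) \<nu> w f * ennreal (l powr (real CARD('n) - \<gamma>))"
proof -
  let ?Q = "cube y l" and ?N = "morrey_norm p (p / q) \<nu> w f"
  define V where "V = l ^ CARD('n)"
  define p' where "p' = conj_exp p"
  define Mw where "Mw = emean ?Q (\<lambda>x. ennreal (w x powr r))"
  define M\<nu> where "M\<nu> = emean ?Q (neg_power \<nu> (p' / p))"
  define e where "e = \<gamma> / real CARD('n) + 1 / q - 1 / p"
  have p': "1 < p'" "1 / p' = 1 - 1 / p"
    using pq by (auto simp: p'_def conj_exp_def field_simps)
  have V: "0 < V" using \<open>0 < l\<close> by (simp add: V_def)
  have [measurable]: "w \<in> borel_measurable lebesgue" "\<nu> \<in> borel_measurable lebesgue"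
    "f \<in> borel_measurable lebesgue"
    using w \<nu> f by (auto simp: weight_def loc_integrable_measurable morrey_space_def)
  have nonneg: "\<And>x. 0 \<le> w x" "\<And>x. 0 \<le> \<nu> x" using w \<nu> by (auto simp: weight_def)
  have C': "ennreal (V powr e) * epow Mw (1 / (r * q)) * epow M\<nu> (1 / p') \<le> ennreal C"
    using C \<open>0 < l\<close> by (simp add: V_def Mw_def M\<nu>_def p'_def e_def measure_cube)
  have W: "epow (wmeasure w ?Q) (1 / q) \<le> ennreal (V powr (1 / q)) * epow Mw (1 / (r * q))"
  proof (cases "Mw = \<infinity>")
    \<comment> \<open>The right-hand side is infinite.\<close>
    case True
    then show ?thesis
      using V pq r by (simp add: epow_top ennreal_mult_top)
  next
    case False
    have "epow (wmeasure w ?Q) (1 / q) \<le> epow (ennreal V * epow Mw (1 / r)) (1 / q)"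
      unfolding V_def Mw_def using pq r nonneg \<open>0 < l\<close>
      by (intro epow_mono wmeasure_le_power_mean) auto
    also have "\<dots> = ennreal (V powr (1 / q)) * epow Mw (1 / (r * q))"
    proof -
      have "epow Mw (1 / r) < \<infinity>"
        using False r by (cases Mw) (auto simp: epow_ennreal)
      then show ?thesis
        using V pq r by (simp add: epow_mult_real epow_epow)
    qed
    finally show ?thesis .
  qed
  have N: "epow (\<integral>\<^sup>+x\<in>?Q. ennreal (norm (f x) powr p * \<nu> x) \<partial>lebesgue) (1 / p)
      \<le> ?N * (ennreal (V powr (1 / q)) * epow Mw (1 / (r * q)))"
  proof -
    have "epow (\<integral>\<^sup>+x\<in>?Q. ennreal (norm (f x) powr p * \<nu> x) \<partial>lebesgue) (1 / p)
        \<le> ?N * epow (wmeasure w ?Q) (1 / q)"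
      using morrey_norm_cube[OF f \<open>0 < l\<close>, of y] wmeasure_finite[OF w, of ?Q] pq by simp
    also have "\<dots> \<le> ?N * (ennreal (V powr (1 / q)) * epow Mw (1 / (r * q)))"
      by (intro mult_left_mono W) auto
    finally show ?thesis .
  qed
  have exps: "ennreal (V powr (1 / q)) * ennreal (V powr (1 / p'))
      = ennreal (V powr e) * ennreal (V powr (1 - \<gamma> / real CARD('n)))"
  proof -
    have "V powr (1 / q) * V powr (1 / p') = V powr e * V powr (1 - \<gamma> / real CARD('n))"
      unfolding powr_add[symmetric] p'(2) e_def by (rule arg_cong[of _ _ "(powr) V"]) simp
    then show ?thesis by (simp add: ennreal_mult'[symmetric])
  qed
  have "(\<integral>\<^sup>+x\<in>?Q. ennreal (norm (f x)) \<partial>lebesgue)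
     \<le> epow (\<integral>\<^sup>+x\<in>?Q. ennreal (norm (f x) powr p * \<nu> x) \<partial>lebesgue) (1 / p)
       * epow (\<integral>\<^sup>+x\<in>?Q. neg_power \<nu> (p' / p) x \<partial>lebesgue) (1 / p')"
    unfolding p'_def using pq nonneg \<open>0 < l\<close> fin by (intro nn_integral_cube_le_weighted) auto
  also have "epow (\<integral>\<^sup>+x\<in>?Q. neg_power \<nu> (p' / p) x \<partial>lebesgue) (1 / p')
      = ennreal (V powr (1 / p')) * epow M\<nu> (1 / p')"
  proof -
    have "epow (ennreal V * M\<nu>) (1 / p') = ennreal (V powr (1 / p')) * epow M\<nu> (1 / p')"
      using fin V p'(1) by (intro epow_mult_real) (auto simp: M\<nu>_def p'_def)
    then show ?thesis
      unfolding emean_cube_mult[OF \<open>0 < l\<close>] M\<nu>_def V_def .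
  qed
  also have "epow (\<integral>\<^sup>+x\<in>?Q. ennreal (norm (f x) powr p * \<nu> x) \<partial>lebesgue) (1 / p)
        * (ennreal (V powr (1 / p')) * epow M\<nu> (1 / p'))
      \<le> ?N * (ennreal (V powr (1 / q)) * epow Mw (1 / (r * q)))
        * (ennreal (V powr (1 / p')) * epow M\<nu> (1 / p'))"
    by (intro mult_right_mono N) auto
  also have "\<dots> = (ennreal (V powr (1 / q)) * ennreal (V powr (1 / p')))
        * epow Mw (1 / (r * q)) * epow M\<nu> (1 / p') * ?N"
    by (simp only: mult_ac)
  also have "\<dots> = (ennreal (V powr e) * epow Mw (1 / (r * q)) * epow M\<nu> (1 / p')) * ?N
        * ennreal (V powr (1 - \<gamma> / real CARD('n)))"
    unfolding exps by (simp only: mult_ac)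
  also have "\<dots> \<le> ennreal C * ?N * ennreal (V powr (1 - \<gamma> / real CARD('n)))"
    by (intro mult_right_mono C') auto
  also have "V powr (1 - \<gamma> / real CARD('n)) = l powr (real CARD('n) - \<gamma>)"
    using \<open>0 < l\<close> by (simp add: V_def powr_realpow[symmetric] powr_powr right_diff_distrib)
  finally show ?thesis .
qed

section \<open>The Riesz kernel\<close>

lemma riesz_kernel_nonneg [simp]: "0 \<le> riesz_kernel \<gamma> z"
  by (simp add: riesz_kernel_def)

lemma riesz_kernel_measurable: "riesz_kernel \<gamma> \<in> borel_measurable borel"
  unfolding riesz_kernel_def by measurable

lemma riesz_kernel_pair_measurable [measurable]:
  "(\<lambda>p. riesz_kernel \<gamma> (fst p - snd p)) \<in> borel_measurable (lebesgue \<Otimes>\<^sub>M lebesgue)"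
proof -
  have "id \<circ> fst \<in> borel_measurable (lebesgue \<Otimes>\<^sub>M lebesgue)"
    "id \<circ> snd \<in> borel_measurable (lebesgue \<Otimes>\<^sub>M lebesgue)"
    by (rule measurable_comp measurable_fst measurable_snd id_borel_measurable_lebesgue)+
  then have "(\<lambda>p. fst p - snd p) \<in> borel_measurable (lebesgue \<Otimes>\<^sub>M lebesgue)"
    unfolding comp_def id_def by (rule borel_measurable_diff)
  then show ?thesis by (rule measurable_compose[OF _ riesz_kernel_measurable])
qed

lemma riesz_kernel_shift_measurable [measurable]:
  "(\<lambda>z. riesz_kernel \<gamma> (x - z)) \<in> borel_measurable lebesgue"
  "(\<lambda>z. riesz_kernel \<gamma> (z - x)) \<in> borel_measurable lebesgue"
  using riesz_kernel_measurable
  by (auto intro!: measurable_completion measurable_compose[OF _ riesz_kernel_measurable])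

lemma powr_neg_diff_le:
  fixes a b :: real
  assumes "0 < \<rho>" "\<rho> \<le> a" "\<rho> \<le> b" "0 \<le> s"
  shows "\<bar>a powr - s - b powr - s\<bar> \<le> s * \<rho> powr (- s - 1) * \<bar>a - b\<bar>"
proof -
  have "norm (a powr - s - b powr - s) \<le> (s * \<rho> powr (- s - 1)) * norm (a - b)"
  proof (rule field_differentiable_bound[of "{\<rho>..}" "\<lambda>t. t powr - s" "\<lambda>t. - s * t powr (- s - 1)"])
    show "((\<lambda>t. t powr - s) has_field_derivative - s * t powr (- s - 1)) (at t within {\<rho>..})"
      if "t \<in> {\<rho>..}" for t
      using that assms by (auto intro!: derivative_eq_intros)
    show "norm (- s * t powr (- s - 1)) \<le> s * \<rho> powr (- s - 1)" if "t \<in> {\<rho>..}" for t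
      using that assms by (auto simp: abs_mult intro!: mult_left_mono powr_mono2')
  qed (use assms in auto)
  then show ?thesis by simp
qed

lemma riesz_kernel_diff_le:
  fixes x x' y :: "real ^ 'n"
  assumes "0 \<le> s" "s = real CARD('n) - \<gamma>"
    and "0 < \<rho>" "\<rho> \<le> norm (x - y)" "\<rho> \<le> norm (x' - y)"
  shows "\<bar>riesz_kernel \<gamma> (x - y) - riesz_kernel \<gamma> (x' - y)\<bar> \<le> s * \<rho> powr (- s - 1) * norm (x - x')"
proof -
  have "\<bar>riesz_kernel \<gamma> (x - y) - riesz_kernel \<gamma> (x' - y)\<bar>
      \<le> s * \<rho> powr (- s - 1) * \<bar>norm (x - y) - norm (x' - y)\<bar>"
    using powr_neg_diff_le[OF assms(3-5,1)] assms(2)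
    by (simp only: riesz_kernel_def powr_minus_divide)
  also have "\<dots> \<le> s * \<rho> powr (- s - 1) * norm (x - x')"
    using norm_triangle_ineq3[of "x - y" "x' - y"] assms(1) by (intro mult_left_mono) auto
  finally show ?thesis .
qed

section \<open>Dyadic estimates\<close>

lemma suminf_ennreal_geometric:
  fixes c t :: real
  assumes "0 \<le> c" "0 \<le> t" "t < 1"
  shows "(\<Sum>j. ennreal (c * t ^ j)) = ennreal (c / (1 - t))"
proof -
  have "(\<lambda>j. c * t ^ j) sums (c * (1 / (1 - t)))"
    using assms by (intro sums_mult geometric_sums) auto
  then show ?thesis
    using assms by (intro suminf_ennreal_eq) (auto simp: zero_le_mult_iff)
qed

lemma dyadic_shell_outer:
  fixes t R :: real
  assumes "0 < R" "R \<le> t"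
  obtains j where "2 ^ j * R \<le> t" "t \<le> 2 * 2 ^ j * R"
proof -
  let ?P = "\<lambda>j. t \<le> 2 * 2 ^ j * R"
  define j where "j = (LEAST j. ?P j)"
  obtain j0 where "t / R < 2 ^ j0" using real_arch_pow[of 2 "t / R"] by auto
  then have "t \<le> 2 ^ j0 * R" using \<open>0 < R\<close> by (simp add: field_simps)
  also have "\<dots> \<le> 2 * 2 ^ j0 * R" using \<open>0 < R\<close> by simp
  finally have le: "?P j" unfolding j_def by (rule LeastI)
  have ge: "2 ^ j * R \<le> t"
  proof (cases j)
    case 0
    then show ?thesis using assms by simp
  next
    case (Suc i)
    then have "\<not> ?P i" unfolding j_def by (intro not_less_Least) simp
    then show ?thesis using Suc by simp
  qed
  show thesis using ge le by (rule that)
qed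

lemma dyadic_shell_inner:
  fixes t \<rho> :: real
  assumes "0 < t" "t \<le> \<rho>"
  obtains j where "\<rho> / (2 * 2 ^ j) \<le> t" "t \<le> \<rho> / 2 ^ j"
proof -
  obtain j where "2 ^ j * t \<le> \<rho>" "\<rho> \<le> 2 * 2 ^ j * t"
    using dyadic_shell_outer[OF assms] .
  then show thesis using that[of j] by (simp add: field_simps)
qed

text \<open>On the shell \<open>2\<^sup>j R \<le> |z - y| \<le> 2\<^sup>j\<^sup>+\<^sup>1 R\<close> the weight is at most \<open>(2\<^sup>j R)\<^sup>-\<^sup>s\<^sup>-\<^sup>1\<close>, and the integral
  of \<open>g\<close> over a cube containing the shell is at most \<open>A (4 \<cdot> 2\<^sup>j R)\<^sup>s\<close>. The products form a geometric
  series.\<close>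

lemma nn_integral_far:
  fixes g :: "real ^ 'n \<Rightarrow> ennreal"
  assumes g[measurable]: "g \<in> borel_measurable lebesgue"
    and bound: "\<And>l. 0 < l \<Longrightarrow> (\<integral>\<^sup>+z\<in>cube y l. g z \<partial>lebesgue) \<le> A * ennreal (l powr s)"
    and "0 \<le> s" "0 < R"
  shows "(\<integral>\<^sup>+z\<in>{z. R \<le> norm (z - y)}. ennreal (norm (z - y) powr (- s - 1)) * g z \<partial>lebesgue)
    \<le> ennreal (2 * 4 powr s / R) * A"
proof -
  define T where "T j z = ennreal ((2 ^ j * R) powr (- s - 1)) * (g z * indicator (cube y (4 * (2 ^ j * R))) z)"
    for j :: nat and z
  have "(\<integral>\<^sup>+z\<in>{z. R \<le> norm (z - y)}. ennreal (norm (z - y) powr (- s - 1)) * g z \<partial>lebesgue)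
      \<le> (\<integral>\<^sup>+z. (\<Sum>j. T j z) \<partial>lebesgue)"
  proof (intro nn_integral_mono)
    fix z :: "real ^ 'n"
    show "ennreal (norm (z - y) powr (- s - 1)) * g z * indicator {z. R \<le> norm (z - y)} z
      \<le> (\<Sum>j. T j z)"
    proof (cases "R \<le> norm (z - y)")
      case True
      then obtain j where j: "2 ^ j * R \<le> norm (z - y)" "norm (z - y) \<le> 2 * 2 ^ j * R"
        using dyadic_shell_outer[OF \<open>0 < R\<close>] by blast
      then have "z \<in> cube y (4 * (2 ^ j * R))" by (intro mem_cube_if_norm_le) (simp add: mult_ac)
      moreover have "norm (z - y) powr (- s - 1) \<le> (2 ^ j * R) powr (- s - 1)"
        using j \<open>0 < R\<close> \<open>0 \<le> s\<close> by (intro powr_mono2') auto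
      ultimately have "ennreal (norm (z - y) powr (- s - 1)) * g z \<le> T j z"
        by (auto simp: T_def intro!: mult_right_mono ennreal_leI)
      also have "\<dots> \<le> (\<Sum>j. T j z)"
        using sum_le_suminf[of "\<lambda>j. T j z" "{j}"] by simp
      finally show ?thesis using True by simp
    qed simp
  qed
  also have "\<dots> = (\<Sum>j. \<integral>\<^sup>+z. T j z \<partial>lebesgue)"
    unfolding T_def by (intro nn_integral_suminf) measurable
  also have "\<dots> \<le> (\<Sum>j. ennreal (4 powr s / R * (1 / 2) ^ j) * A)"
  proof (intro suminf_le)
    fix j
    have pos: "0 < 2 ^ j * R" using \<open>0 < R\<close> by simp
    have "(\<integral>\<^sup>+z. T j z \<partial>lebesgue)
        = ennreal ((2 ^ j * R) powr (- s - 1)) * (\<integral>\<^sup>+z\<in>cube y (4 * (2 ^ j * R)). g z \<partial>lebesgue)"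
      unfolding T_def by (intro nn_integral_cmult) measurable
    also have "\<dots> \<le> ennreal ((2 ^ j * R) powr (- s - 1)) * (A * ennreal ((4 * (2 ^ j * R)) powr s))"
      using pos by (intro mult_left_mono bound) auto
    also have "\<dots> = ennreal ((2 ^ j * R) powr (- s - 1) * (4 * (2 ^ j * R)) powr s) * A"
      by (simp add: ennreal_mult' mult_ac)
    also have "(2 ^ j * R) powr (- s - 1) * (4 * (2 ^ j * R)) powr s
        = 4 powr s * ((2 ^ j * R) powr (- s - 1) * (2 ^ j * R) powr s)"
      using \<open>0 < R\<close> by (simp add: powr_mult)
    also have "(2 ^ j * R) powr (- s - 1) * (2 ^ j * R) powr s = 1 / (2 ^ j * R)"
      using pos by (simp only: powr_add[symmetric]) (simp add: powr_minus_divide)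
    also have "4 powr s * (1 / (2 ^ j * R)) = 4 powr s / R * (1 / 2) ^ j"
      by (simp add: power_divide)
    finally show "(\<integral>\<^sup>+z. T j z \<partial>lebesgue) \<le> ennreal (4 powr s / R * (1 / 2) ^ j) * A" .
  qed auto
  also have "\<dots> = (\<Sum>j. ennreal (4 powr s / R * (1 / 2) ^ j)) * A"
    by (rule ennreal_suminf_multc)
  also have "(\<Sum>j. ennreal (4 powr s / R * (1 / 2) ^ j)) = ennreal (4 powr s / R / (1 - 1 / 2))"
    using \<open>0 < R\<close> by (intro suminf_ennreal_geometric) auto
  finally show ?thesis by (simp add: mult.commute)
qed

text \<open>The same decomposition into the shells \<open>2\<^sup>-\<^sup>j\<^sup>-\<^sup>1 \<rho> \<le> |x - y| \<le> 2\<^sup>-\<^sup>j \<rho>\<close>, now with Lebesgue measure.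
  The ratio of the series is \<open>2\<^sup>-\<^sup>\<gamma>\<close>, which is less than \<open>1\<close> because \<open>\<gamma> > 0\<close>.\<close>

lemma nn_integral_riesz_kernel_ball:
  fixes y :: "real ^ 'n"
  assumes "0 < \<gamma>" "s = real CARD('n) - \<gamma>" "0 \<le> s" "0 < \<rho>"
  shows "(\<integral>\<^sup>+x\<in>{x. norm (x - y) \<le> \<rho>}. ennreal (riesz_kernel \<gamma> (x - y)) \<partial>lebesgue)
    \<le> ennreal (2 powr (s + real CARD('n)) * \<rho> powr \<gamma> / (1 - 2 powr - \<gamma>))"
proof -
  define T where "T j x = ennreal ((\<rho> / (2 * 2 ^ j)) powr - s) * indicator (cube y (2 * (\<rho> / 2 ^ j))) x"
    for j :: nat and x
  have "(\<integral>\<^sup>+x\<in>{x. norm (x - y) \<le> \<rho>}. ennreal (riesz_kernel \<gamma> (x - y)) \<partial>lebesgue)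
      \<le> (\<integral>\<^sup>+x. (\<Sum>j. T j x) \<partial>lebesgue)"
  proof (intro nn_integral_mono)
    fix x :: "real ^ 'n"
    show "ennreal (riesz_kernel \<gamma> (x - y)) * indicator {x. norm (x - y) \<le> \<rho>} x \<le> (\<Sum>j. T j x)"
    proof (cases "x \<noteq> y \<and> norm (x - y) \<le> \<rho>")
      case True
      then obtain j where j: "\<rho> / (2 * 2 ^ j) \<le> norm (x - y)" "norm (x - y) \<le> \<rho> / 2 ^ j"
        using dyadic_shell_inner[of "norm (x - y)" \<rho>] by auto
      then have "x \<in> cube y (2 * (\<rho> / 2 ^ j))" by (intro mem_cube_if_norm_le) simp
      moreover have "norm (x - y) powr - s \<le> (\<rho> / (2 * 2 ^ j)) powr - s"
        using j \<open>0 < \<rho>\<close> \<open>0 \<le> s\<close> by (intro powr_mono2') auto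
      moreover have "riesz_kernel \<gamma> (x - y) = norm (x - y) powr - s"
        using assms(2) by (simp only: riesz_kernel_def powr_minus_divide)
      ultimately have "ennreal (riesz_kernel \<gamma> (x - y)) \<le> T j x"
        by (auto simp: T_def intro!: ennreal_leI)
      also have "\<dots> \<le> (\<Sum>j. T j x)"
        using sum_le_suminf[of "\<lambda>j. T j x" "{j}"] by simp
      finally show ?thesis using True by simp
    next
      case False
      then have "ennreal (riesz_kernel \<gamma> (x - y)) * indicator {x. norm (x - y) \<le> \<rho>} x = 0"
        by (auto simp: riesz_kernel_def)
      then show ?thesis by (simp only: zero_le)
    qed
  qed
  also have "\<dots> = (\<Sum>j. \<integral>\<^sup>+x. T j x \<partial>lebesgue)"
    unfolding T_def by (intro nn_integral_suminf) measurable
  also have "\<dots> = (\<Sum>j. ennreal (2 powr (s + real CARD('n)) * \<rho> powr \<gamma> * (2 powr - \<gamma>) ^ j))"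
  proof (intro suminf_cong)
    fix j :: nat
    have "(\<integral>\<^sup>+x. T j x \<partial>lebesgue)
        = ennreal ((\<rho> / (2 * 2 ^ j)) powr - s) * ennreal ((2 * (\<rho> / 2 ^ j)) ^ CARD('n))"
      unfolding T_def using \<open>0 < \<rho>\<close> by (simp add: nn_integral_cmult emeasure_cube)
    also have "\<dots> = ennreal ((\<rho> / (2 * 2 ^ j)) powr - s * (2 * (\<rho> / 2 ^ j)) powr real CARD('n))"
      using \<open>0 < \<rho>\<close> by (simp add: ennreal_mult'[symmetric] powr_realpow)
    also have "(\<rho> / (2 * 2 ^ j)) powr - s * (2 * (\<rho> / 2 ^ j)) powr real CARD('n)
       = 2 powr (s + real CARD('n)) * \<rho> powr \<gamma> * (2 powr - \<gamma>) ^ j"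
    proof -
      have "(\<rho> / (2 * 2 ^ j)) powr - s * (2 * (\<rho> / 2 ^ j)) powr real CARD('n)
        = (2 powr s * \<rho> powr - s * 2 powr (real j * s)) *
          (2 powr real CARD('n) * \<rho> powr real CARD('n) * 2 powr (- real j * real CARD('n)))"
        using \<open>0 < \<rho>\<close>
        by (simp add: powr_mult powr_divide powr_realpow[symmetric] powr_powr powr_minus field_simps)
      also have "\<dots> = 2 powr (s + real CARD('n)) * \<rho> powr (- s + real CARD('n))
          * 2 powr (real j * s - real j * real CARD('n))"
        by (simp add: powr_add powr_diff powr_minus divide_inverse)
      also have "real j * s - real j * real CARD('n) = - \<gamma> * real j"
        unfolding assms(2) by (simp add: algebra_simps)
      also have "- s + real CARD('n) = \<gamma>" using assms(2) by simp
      also have "2 powr (- \<gamma> * real j) = (2 powr - \<gamma>) ^ j"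
        by (simp only: powr_powr[symmetric]) (simp add: powr_realpow)
      finally show ?thesis .
    qed
    finally show "(\<integral>\<^sup>+x. T j x \<partial>lebesgue)
      = ennreal (2 powr (s + real CARD('n)) * \<rho> powr \<gamma> * (2 powr - \<gamma>) ^ j)" .
  qed
  also have "\<dots> = ennreal (2 powr (s + real CARD('n)) * \<rho> powr \<gamma> / (1 - 2 powr - \<gamma>))"
    using \<open>0 < \<gamma>\<close> by (intro suminf_ennreal_geometric) (auto intro: powr_less_one)
  finally show ?thesis .
qed

section \<open>Near part and kernel differences\<close>

lemma sigma_finite_lebesgue: "sigma_finite_measure (lebesgue :: 'a::euclidean_space measure)"
proof
  obtain A :: "'a set set" where "countable A" "A \<subseteq> sets lborel" "\<Union>A = space lborel"
    "\<forall>a\<in>A. emeasure lborel a \<noteq> \<infinity>"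
    using sigma_finite_measure.sigma_finite_countable[OF sigma_finite_lborel] by blast
  then show "\<exists>A::'a set set. countable A \<and> A \<subseteq> sets lebesgue \<and> \<Union>A = space lebesgue \<and>
      (\<forall>a\<in>A. emeasure lebesgue a \<noteq> \<infinity>)"
    by (intro exI[of _ A]) (auto simp: subset_iff)
qed

lemma pair_sigma_finite_lebesgue:
  "pair_sigma_finite (lebesgue :: 'a::euclidean_space measure) (lebesgue :: 'b::euclidean_space measure)"
  by (intro pair_sigma_finite.intro sigma_finite_lebesgue)

text \<open>The potential of the part of \<open>g\<close> near the cube \<open>cube y l\<close>: the ball of radius \<open>\<surd>n l\<close> has
  twice the circumradius of the cube.\<close>

definition near_potential ::
  "real \<Rightarrow> (real ^ 'n \<Rightarrow> ennreal) \<Rightarrow> real ^ 'n \<Rightarrow> real \<Rightarrow> real ^ 'n \<Rightarrow> ennreal" where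
  "near_potential \<gamma> g y l x =
     (\<integral>\<^sup>+z\<in>ball y (sqrt (real CARD('n)) * l). ennreal (riesz_kernel \<gamma> (x - z)) * g z \<partial>lebesgue)"

lemma ball_lebesgue [measurable]: "ball y r \<in> sets (lebesgue :: 'a::euclidean_space measure)"
  by simp

lemma near_potential_measurable [measurable]:
  fixes g :: "real ^ 'n \<Rightarrow> ennreal"
  assumes [measurable]: "g \<in> borel_measurable lebesgue"
  shows "near_potential \<gamma> g y l \<in> borel_measurable lebesgue"
proof -
  interpret L: sigma_finite_measure "lebesgue :: (real ^ 'n) measure"
    by (rule sigma_finite_lebesgue)
  show ?thesis unfolding near_potential_def by measurable
qed

text \<open>If \<open>\<integral>\<^sub>Q g \<le> A l\<^sup>n\<^sup>-\<^sup>\<gamma>\<close> for all cubes, the mean of the near potential over its cube is at most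
  \<open>A\<close> times this constant. The dimension enters through the type argument.\<close>

definition near_const :: "real \<Rightarrow> 'n::finite itself \<Rightarrow> real" where
  "near_const \<gamma> _ = (let n = real CARD('n) in
     2 powr (2 * n - \<gamma>) / (1 - 2 powr - \<gamma>) * (2 * sqrt n) powr n)"

lemma near_const_nonneg: "0 < \<gamma> \<Longrightarrow> 0 \<le> near_const \<gamma> TYPE('n::finite)"
  using powr_less_one[of 2 "- \<gamma>"]
  by (auto simp: near_const_def Let_def intro!: mult_nonneg_nonneg divide_nonneg_nonneg)

text \<open>By Tonelli's theorem the kernel is integrated first, over \<open>x\<close>, which contributes \<open>l\<^sup>\<gamma>\<close>; the
  integral of \<open>g\<close> over the larger cube then contributes \<open>l\<^sup>s\<close>, and \<open>\<gamma> + s = n\<close>.\<close>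

lemma nn_integral_near_potential:
  fixes g :: "real ^ 'n \<Rightarrow> ennreal"
  assumes g[measurable]: "g \<in> borel_measurable lebesgue"
    and bound: "\<And>y l. 0 < l \<Longrightarrow> (\<integral>\<^sup>+z\<in>cube y l. g z \<partial>lebesgue) \<le> A * ennreal (l powr s)"
    and "0 < \<gamma>" "s = real CARD('n) - \<gamma>" "0 \<le> s" "0 < l"
  shows "(\<integral>\<^sup>+x\<in>cube y l. near_potential \<gamma> g y l x \<partial>lebesgue)
    \<le> ennreal (near_const \<gamma> TYPE('n)) * A * ennreal (l ^ CARD('n))"
proof -
  interpret P: pair_sigma_finite "lebesgue :: (real ^ 'n) measure" "lebesgue :: (real ^ 'n) measure"
    by (rule pair_sigma_finite_lebesgue)
  let ?n = "real CARD('n)"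
  define R where "R = sqrt ?n * l"
  have R: "0 < R" using \<open>0 < l\<close> by (simp add: R_def)
  define K where "K = 2 powr (s + ?n) * (2 * R) powr \<gamma> / (1 - 2 powr - \<gamma>)"
  have "(\<integral>\<^sup>+x\<in>cube y l. near_potential \<gamma> g y l x \<partial>lebesgue)
    = (\<integral>\<^sup>+x. \<integral>\<^sup>+z. ennreal (riesz_kernel \<gamma> (x - z)) * g z * indicator (ball y R) z * indicator (cube y l) x
        \<partial>lebesgue \<partial>lebesgue)"
    unfolding near_potential_def R_def by (intro nn_integral_cong nn_integral_multc[symmetric]) measurable
  also have "\<dots> = (\<integral>\<^sup>+z. \<integral>\<^sup>+x. ennreal (riesz_kernel \<gamma> (x - z)) * g z * indicator (ball y R) z * indicator (cube y l) x
        \<partial>lebesgue \<partial>lebesgue)"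
    by (rule P.Fubini'[symmetric]) measurable
  also have "\<dots> \<le> (\<integral>\<^sup>+z. ennreal K * (g z * indicator (cube y (2 * R)) z) \<partial>lebesgue)"
  proof (intro nn_integral_mono)
    fix z :: "real ^ 'n"
    show "(\<integral>\<^sup>+x. ennreal (riesz_kernel \<gamma> (x - z)) * g z * indicator (ball y R) z * indicator (cube y l) x \<partial>lebesgue)
      \<le> ennreal K * (g z * indicator (cube y (2 * R)) z)"
    proof (cases "z \<in> ball y R")
      case True
      then have zc: "z \<in> cube y (2 * R)"
        by (intro mem_cube_if_norm_le) (simp add: dist_norm norm_minus_commute)
      have "{x. norm (x - z) \<le> 2 * R} = cball z (2 * R)"
        by (auto simp: dist_norm norm_minus_commute)
      then have [measurable]: "{x. norm (x - z) \<le> 2 * R} \<in> sets lebesgue" by simp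
      have "(\<integral>\<^sup>+x. ennreal (riesz_kernel \<gamma> (x - z)) * g z * indicator (ball y R) z * indicator (cube y l) x \<partial>lebesgue)
        \<le> (\<integral>\<^sup>+x. ennreal (riesz_kernel \<gamma> (x - z)) * indicator {x. norm (x - z) \<le> 2 * R} x * g z \<partial>lebesgue)"
      proof (intro nn_integral_mono)
        fix x
        \<comment> \<open>\<open>R\<close> is twice the circumradius of the cube, so the distance is even at most \<open>3 R / 2\<close>.\<close>
        have "norm (x - z) \<le> 2 * R" if "x \<in> cube y l"
          using norm_le_if_mem_cube[OF that] True R norm_triangle_ineq[of "x - y" "y - z"]
          by (simp add: R_def dist_norm)
        then show "ennreal (riesz_kernel \<gamma> (x - z)) * g z * indicator (ball y R) z * indicator (cube y l) x
          \<le> ennreal (riesz_kernel \<gamma> (x - z)) * indicator {x. norm (x - z) \<le> 2 * R} x * g z"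
          by (auto simp: indicator_def)
      qed
      also have "\<dots> = (\<integral>\<^sup>+x\<in>{x. norm (x - z) \<le> 2 * R}. ennreal (riesz_kernel \<gamma> (x - z)) \<partial>lebesgue) * g z"
        by (intro nn_integral_multc) measurable
      also have "\<dots> \<le> ennreal K * g z"
        unfolding K_def using assms(3-5) R
        by (intro mult_right_mono nn_integral_riesz_kernel_ball) auto
      finally show ?thesis using zc by simp
    qed simp
  qed
  also have "\<dots> = ennreal K * (\<integral>\<^sup>+z\<in>cube y (2 * R). g z \<partial>lebesgue)"
    by (intro nn_integral_cmult) measurable
  also have "\<dots> \<le> ennreal K * (A * ennreal ((2 * R) powr s))"
    using R by (intro mult_left_mono bound) auto
  also have "\<dots> = ennreal (K * (2 * R) powr s) * A"
    using R by (simp add: ennreal_mult'' mult_ac)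
  also have "K * (2 * R) powr s = near_const \<gamma> TYPE('n) * l ^ CARD('n)"
  proof -
    have "K * (2 * R) powr s = 2 powr (s + ?n) / (1 - 2 powr - \<gamma>) * (2 * R) powr (\<gamma> + s)"
      by (simp add: K_def powr_add)
    also have "(2 * R) powr (\<gamma> + s) = (2 * sqrt ?n) powr ?n * l powr ?n"
      using assms(4) \<open>0 < l\<close> by (simp add: R_def powr_mult)
    finally show ?thesis
      using assms(4) \<open>0 < l\<close> by (simp add: near_const_def Let_def powr_realpow)
  qed
  also have "ennreal (near_const \<gamma> TYPE('n) * l ^ CARD('n)) * A
      = ennreal (near_const \<gamma> TYPE('n)) * A * ennreal (l ^ CARD('n))"
    using \<open>0 < l\<close> by (simp add: ennreal_mult'' mult_ac)
  finally show ?thesis .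
qed

text \<open>Under the same hypothesis, with \<open>s = n - \<gamma>\<close>, the complement of the ball contributes at most \<open>A\<close>
  times this constant to the integral of a kernel difference against \<open>g\<close>. The first two factors come from the mean value theorem, the last one from summing over the shells.\<close>

definition far_const :: "real \<Rightarrow> real" where
  "far_const s = s * 2 powr (s + 1) * (2 * 4 powr s)"

lemma far_const_nonneg: "0 \<le> s \<Longrightarrow> 0 \<le> far_const s"
  by (simp add: far_const_def)

text \<open>Outside the ball of radius \<open>R = \<surd>n l\<close> the mean value theorem gains a factor \<open>l / |z - y|\<close> over the
  size of the kernel, so the integral converges there although each kernel alone may diverge.\<close>

lemma nn_integral_kernel_diff:
  fixes g :: "real ^ 'n \<Rightarrow> ennreal"
  assumes g[measurable]: "g \<in> borel_measurable lebesgue"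
    and bound: "\<And>y l. 0 < l \<Longrightarrow> (\<integral>\<^sup>+z\<in>cube y l. g z \<partial>lebesgue) \<le> A * ennreal (l powr s)"
    and "s = real CARD('n) - \<gamma>" "0 \<le> s" "0 < l"
    and x: "x \<in> cube y l" "x' \<in> cube y l"
  shows "(\<integral>\<^sup>+z. ennreal \<bar>riesz_kernel \<gamma> (x - z) - riesz_kernel \<gamma> (x' - z)\<bar> * g z \<partial>lebesgue)
    \<le> near_potential \<gamma> g y l x + near_potential \<gamma> g y l x' + ennreal (far_const s) * A"
proof -
  define R where "R = sqrt (real CARD('n)) * l"
  have R: "0 < R" using \<open>0 < l\<close> by (simp add: R_def)
  let ?k = "\<lambda>x z. riesz_kernel \<gamma> (x - z)"
  define F where "F = {z. R \<le> norm (z - y)}"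
  have [measurable]: "F \<in> sets lebesgue"
    unfolding F_def by (intro sets_completionI_sets) simp
  define c where "c = s * 2 powr (s + 1) * R"
  have c: "0 \<le> c" using R \<open>0 \<le> s\<close> by (simp add: c_def)
  have near: "norm (x - y) \<le> R / 2" "norm (x' - y) \<le> R / 2"
    using x norm_le_if_mem_cube by (auto simp: R_def)
  have "(\<integral>\<^sup>+z. ennreal \<bar>?k x z - ?k x' z\<bar> * g z \<partial>lebesgue)
    \<le> (\<integral>\<^sup>+z. ennreal (?k x z) * g z * indicator (ball y R) z
        + ennreal (?k x' z) * g z * indicator (ball y R) z
        + ennreal c * (ennreal (norm (z - y) powr (- s - 1)) * g z * indicator F z) \<partial>lebesgue)"
  proof (intro nn_integral_mono)
    fix z :: "real ^ 'n"
    show "ennreal \<bar>?k x z - ?k x' z\<bar> * g z \<le> ennreal (?k x z) * g z * indicator (ball y R) z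
        + ennreal (?k x' z) * g z * indicator (ball y R) z
        + ennreal c * (ennreal (norm (z - y) powr (- s - 1)) * g z * indicator F z)"
    proof (cases "norm (z - y) < R")
      case True
      then have "z \<in> ball y R" by (simp add: dist_norm norm_minus_commute)
      have "\<bar>?k x z - ?k x' z\<bar> \<le> ?k x z + ?k x' z"
        using riesz_kernel_nonneg[of \<gamma> "x - z"] riesz_kernel_nonneg[of \<gamma> "x' - z"] by linarith
      then have "ennreal \<bar>?k x z - ?k x' z\<bar> * g z \<le> ennreal (?k x z + ?k x' z) * g z"
        by (intro mult_right_mono ennreal_leI) auto
      also have "\<dots> = ennreal (?k x z) * g z + ennreal (?k x' z) * g z"
        by (simp add: distrib_right)
      finally show ?thesis using \<open>z \<in> ball y R\<close> True by (simp add: F_def)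
    next
      case False
      \<comment> \<open>Both points of the cube have distance at least \<open>\<rho>\<close> from \<open>z\<close>.\<close>
      define \<rho> where "\<rho> = norm (z - y) / 2"
      have "0 < norm (z - y)" using False R by linarith
      then have \<rho>: "0 < \<rho>" by (simp add: \<rho>_def)
      have "norm (z - y) \<le> norm (x - z) + norm (x - y)" "norm (z - y) \<le> norm (x' - z) + norm (x' - y)"
        using norm_triangle_ineq[of "z - x" "x - y"] norm_triangle_ineq[of "z - x'" "x' - y"]
        by (simp_all add: norm_minus_commute)
      then have "\<rho> \<le> norm (x - z)" "\<rho> \<le> norm (x' - z)"
        using near False unfolding \<rho>_def by linarith+
      then have "\<bar>?k x z - ?k x' z\<bar> \<le> s * \<rho> powr (- s - 1) * norm (x - x')"
        by (rule riesz_kernel_diff_le[OF assms(4,3) \<rho>])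
      also have "\<dots> \<le> s * \<rho> powr (- s - 1) * R"
      proof (rule mult_left_mono)
        show "norm (x - x') \<le> R"
          using near norm_triangle_ineq4[of "x - y" "x' - y"] by simp
      qed (use \<open>0 \<le> s\<close> in simp)
      also have "\<rho> powr (- s - 1) = 2 powr (s + 1) * norm (z - y) powr (- s - 1)"
      proof -
        have "\<rho> powr (- s - 1) = norm (z - y) powr (- s - 1) / 2 powr (- (s + 1))"
          unfolding \<rho>_def by (simp add: powr_divide)
        also have "\<dots> = 2 powr (s + 1) * norm (z - y) powr (- s - 1)"
          unfolding powr_minus by (simp only: divide_inverse inverse_inverse_eq mult.commute)
        finally show ?thesis .
      qed
      also have "s * (2 powr (s + 1) * norm (z - y) powr (- s - 1)) * R
          = c * norm (z - y) powr (- s - 1)"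
        by (simp add: c_def)
      finally have "ennreal \<bar>?k x z - ?k x' z\<bar> * g z \<le> ennreal (c * norm (z - y) powr (- s - 1)) * g z"
        by (intro mult_right_mono ennreal_leI) auto
      also have "\<dots> = ennreal c * (ennreal (norm (z - y) powr (- s - 1)) * g z * indicator F z)"
        using False c by (simp add: F_def ennreal_mult' mult.assoc)
      finally show ?thesis by (simp add: add_increasing)
    qed
  qed
  also have "\<dots> = near_potential \<gamma> g y l x + near_potential \<gamma> g y l x' + ennreal c *
     (\<integral>\<^sup>+z\<in>F. ennreal (norm (z - y) powr (- s - 1)) * g z \<partial>lebesgue)"
  proof -
    have "(\<lambda>z. norm (z - y) powr (- s - 1)) \<in> borel_measurable lebesgue"
      by (intro measurable_completion) simp
    then have [measurable]:
      "(\<lambda>z. ennreal (norm (z - y) powr (- s - 1)) * g z * indicator F z) \<in> borel_measurable lebesgue"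
      by measurable
    show ?thesis
      unfolding near_potential_def R_def[symmetric]
      by (subst nn_integral_add nn_integral_cmult; (measurable; fail)?)+
  qed
  also have "\<dots> \<le> near_potential \<gamma> g y l x + near_potential \<gamma> g y l x' + ennreal c * (ennreal (2 * 4 powr s / R) * A)"
    unfolding F_def using assms(4) R by (intro add_left_mono mult_left_mono nn_integral_far bound) auto
  also have "ennreal c * (ennreal (2 * 4 powr s / R) * A) = ennreal (c * (2 * 4 powr s / R)) * A"
    using c by (simp only: ennreal_mult' mult.assoc)
  also have "c * (2 * 4 powr s / R) = far_const s"
    using R by (simp add: c_def far_const_def)
  finally show ?thesis .
qed

section \<open>Mean oscillation\<close>

text \<open>Replacing the mean value by an arbitrary constant costs at most a factor of two.\<close>

lemma mean_oscillation_le: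
  fixes b :: "real ^ 'n \<Rightarrow> complex"
  assumes [measurable]: "b \<in> borel_measurable lebesgue" and "0 < l" "K < \<infinity>"
    and le: "(\<integral>\<^sup>+x\<in>cube y l. ennreal (norm (b x - a)) \<partial>lebesgue) \<le> K * ennreal (l ^ CARD('n))"
  shows "set_integrable lebesgue (cube y l) b"
    and "emean (cube y l) (\<lambda>x. ennreal (norm (b x - mean (cube y l) b))) \<le> 2 * K"
proof -
  let ?Q = "cube y l"
  define V where "V = l ^ CARD('n)"
  have V: "0 < V" using \<open>0 < l\<close> by (simp add: V_def)
  have Q: "emeasure lebesgue ?Q = ennreal V" "measure lebesgue ?Q = V"
    using \<open>0 < l\<close> by (simp_all add: V_def emeasure_cube measure_cube)
  have const: "set_integrable lebesgue ?Q (\<lambda>_. c)" for c :: complex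
    using Q unfolding set_integrable_def by (intro integrable_scaleR_left integrable_real_indicator) auto
  have diff: "set_integrable lebesgue ?Q (\<lambda>x. b x - a)"
  proof -
    have "(\<integral>\<^sup>+x. ennreal (norm (indicator ?Q x *\<^sub>R (b x - a))) \<partial>lebesgue)
      = (\<integral>\<^sup>+x\<in>?Q. ennreal (norm (b x - a)) \<partial>lebesgue)"
      by (intro nn_integral_cong) (auto simp: indicator_def)
    also have "\<dots> < \<infinity>"
      using le \<open>K < \<infinity>\<close> by (simp add: ennreal_mult_less_top le_less_trans)
    finally show ?thesis
      unfolding set_integrable_def by (intro integrableI_bounded) measurable
  qed
  show b: "set_integrable lebesgue ?Q b"
    using set_integral_add(1)[OF diff const[of a]] by simp
  define m where "m = mean ?Q b"
  have int: "(LINT x:?Q|lebesgue. b x - a) = (LINT x:?Q|lebesgue. b x) - V *\<^sub>R a"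
    using set_integral_diff(2)[OF b const[of a]] Q by (simp add: set_lebesgue_integral_def)
  then have m: "m - a = (1 / V) *\<^sub>R (LINT x:?Q|lebesgue. b x - a)"
    unfolding int m_def mean_def using V Q by (simp add: scaleR_diff_right)
  have "ennreal (norm (LINT x:?Q|lebesgue. b x - a))
      \<le> (\<integral>\<^sup>+x. ennreal (norm (indicator ?Q x *\<^sub>R (b x - a))) \<partial>lebesgue)"
    unfolding set_lebesgue_integral_def
    using diff by (intro integral_norm_bound_ennreal) (simp add: set_integrable_def)
  also have "\<dots> = (\<integral>\<^sup>+x\<in>?Q. ennreal (norm (b x - a)) \<partial>lebesgue)"
    by (intro nn_integral_cong) (auto simp: indicator_def)
  also note le
  finally have I: "ennreal (norm (LINT x:?Q|lebesgue. b x - a)) \<le> K * ennreal V"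
    by (simp add: V_def)
  have mV: "ennreal (norm (a - m)) * ennreal V \<le> K * ennreal V"
  proof -
    have "norm (a - m) * V = norm (LINT x:?Q|lebesgue. b x - a)"
      using V by (subst norm_minus_commute) (simp add: m)
    then show ?thesis using I V by (simp add: ennreal_mult''[symmetric])
  qed
  have "(\<integral>\<^sup>+x\<in>?Q. ennreal (norm (b x - m)) \<partial>lebesgue)
      \<le> (\<integral>\<^sup>+x. ennreal (norm (b x - a)) * indicator ?Q x + ennreal (norm (a - m)) * indicator ?Q x \<partial>lebesgue)"
  proof (intro nn_integral_mono)
    fix x
    have "norm (b x - m) \<le> norm (b x - a) + norm (a - m)"
      using norm_triangle_ineq[of "b x - a" "a - m"] by simp
    then show "ennreal (norm (b x - m)) * indicator ?Q x
      \<le> ennreal (norm (b x - a)) * indicator ?Q x + ennreal (norm (a - m)) * indicator ?Q x"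
      by (auto simp: indicator_def ennreal_plus[symmetric] simp del: ennreal_plus)
  qed
  also have "\<dots> = (\<integral>\<^sup>+x\<in>?Q. ennreal (norm (b x - a)) \<partial>lebesgue) + ennreal (norm (a - m)) * ennreal V"
    using \<open>0 < l\<close> by (simp add: nn_integral_add nn_integral_cmult emeasure_cube V_def)
  also have "\<dots> \<le> K * ennreal V + K * ennreal V"
    using le mV by (intro add_mono) (simp_all add: V_def)
  also have "\<dots> = 2 * K * ennreal V" by (simp add: mult_2 distrib_right)
  finally have "emean ?Q (\<lambda>x. ennreal (norm (b x - m))) \<le> 2 * K * ennreal V / ennreal V"
    unfolding emean_def Q by (rule divide_right_mono_ennreal)
  also have "\<dots> = 2 * K"
    using V by (simp add: ennreal_mult_divide_eq)
  finally show "emean ?Q (\<lambda>x. ennreal (norm (b x - mean ?Q b))) \<le> 2 * K"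
    by (simp add: m_def)
qed

section \<open>Potentials of functions in the unweighted Morrey class\<close>

text \<open>The constant relating the unweighted Morrey bound to the BMO norm.\<close>

definition riesz_bmo_const :: "real \<Rightarrow> 'n::finite itself \<Rightarrow> real" where
  "riesz_bmo_const \<gamma> _ = 2 * (\<bar>1 / riesz_const CARD('n) \<gamma>\<bar>
     * (2 * near_const \<gamma> TYPE('n) + far_const (real CARD('n) - \<gamma>)))"

lemma riesz_bmo_const_nonneg:
  assumes "0 < \<gamma>" "\<gamma> \<le> real CARD('n::finite)"
  shows "0 \<le> riesz_bmo_const \<gamma> TYPE('n)"
  unfolding riesz_bmo_const_def using assms
  by (intro mult_nonneg_nonneg add_nonneg_nonneg near_const_nonneg far_const_nonneg) auto

text \<open>The unweighted Morrey condition \<open>\<integral>\<^sub>Q |f| \<le> A l\<^sup>n\<^sup>-\<^sup>\<gamma>\<close> for all cubes \<open>Q\<close> of side length \<open>l\<close>. The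
  bound \<open>A\<close> is an extended number, like the Morrey norm from which it is obtained, but finite.\<close>

locale L1_morrey =
  fixes f :: "real ^ 'n \<Rightarrow> complex" and A :: ennreal and \<gamma> s :: real
  assumes f_measurable [measurable]: "f \<in> borel_measurable lebesgue"
    and A_finite: "A < \<infinity>"
    and bound: "\<And>y l. 0 < l \<Longrightarrow>
      (\<integral>\<^sup>+z\<in>cube y l. ennreal (norm (f z)) \<partial>lebesgue) \<le> A * ennreal (l powr s)"
    and \<gamma>: "0 < \<gamma>" "0 \<le> s" "s = real CARD('n) - \<gamma>"
begin

abbreviation near :: "real ^ 'n \<Rightarrow> real \<Rightarrow> real ^ 'n \<Rightarrow> ennreal" where
  "near \<equiv> near_potential \<gamma> (\<lambda>z. ennreal (norm (f z)))"

text \<open>The integrand of the potential differences that determine an element of BMO.\<close>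

abbreviation kdiff :: "real ^ 'n \<Rightarrow> real ^ 'n \<Rightarrow> real ^ 'n \<Rightarrow> complex" where
  "kdiff x x' z \<equiv> (riesz_kernel \<gamma> (x - z) - riesz_kernel \<gamma> (x' - z)) *\<^sub>R f z"

lemma near_integral:
  assumes "0 < l"
  shows "(\<integral>\<^sup>+x\<in>cube y l. near y l x \<partial>lebesgue)
    \<le> ennreal (near_const \<gamma> TYPE('n)) * A * ennreal (l ^ CARD('n))"
  using assms \<gamma> bound by (intro nn_integral_near_potential) auto

lemma kdiff_nn_integral:
  assumes "0 < l" "x \<in> cube y l" "x' \<in> cube y l"
  shows "(\<integral>\<^sup>+z. ennreal (norm (kdiff x x' z)) \<partial>lebesgue)
    \<le> near y l x + near y l x' + ennreal (far_const s) * A"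
  using nn_integral_kernel_diff[of "\<lambda>z. ennreal (norm (f z))" A s \<gamma> l x y x'] assms \<gamma> bound
  by (simp add: ennreal_mult')

text \<open>The points at which the near potentials are finite, for a sequence of cubes exhausting the space.
  Differences of the potential converge absolutely between any two of them.\<close>

definition good :: "real ^ 'n \<Rightarrow> bool" where
  "good x \<longleftrightarrow> (\<forall>m::nat. x \<in> cube 0 (real (Suc m)) \<longrightarrow> near 0 (real (Suc m)) x < \<infinity>)"

lemma AE_good: "AE x in lebesgue. good x"
  unfolding good_def
proof (subst AE_all_countable, intro allI)
  fix m :: nat
  let ?Q = "cube (0 :: real ^ 'n) (real (Suc m))" and ?u = "near 0 (real (Suc m))"
  have "(\<integral>\<^sup>+x\<in>?Q. ?u x \<partial>lebesgue) < \<infinity>"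
    using near_integral[of "real (Suc m)" 0] A_finite
    by (auto simp: ennreal_mult_less_top elim!: le_less_trans simp del: of_nat_Suc)
  then have "AE x in lebesgue. ?u x * indicator ?Q x \<noteq> \<infinity>"
    by (intro nn_integral_noteq_infinite) auto
  then show "AE x in lebesgue. x \<in> ?Q \<longrightarrow> ?u x < \<infinity>"
    by eventually_elim (auto simp: less_top)
qed

lemma common_cube:
  fixes x x' :: "real ^ 'n"
  obtains m :: nat where "x \<in> cube 0 (real (Suc m))" "x' \<in> cube 0 (real (Suc m))"
proof -
  obtain m :: nat where "max (2 * norm x) (2 * norm x') \<le> real m" using real_arch_simple by blast
  then have "norm x \<le> real (Suc m) / 2" "norm x' \<le> real (Suc m) / 2"
    by simp_all
  then show thesis
    using mem_cube_if_norm_le[of _ 0] that[of m] by (metis diff_zero)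
qed

lemma near_finite_if_integrable:
  assumes "integrable lebesgue (\<lambda>z. riesz_kernel \<gamma> (x - z) *\<^sub>R f z)"
  shows "near y l x < \<infinity>"
proof -
  have "near y l x \<le> (\<integral>\<^sup>+z. ennreal (norm (riesz_kernel \<gamma> (x - z) *\<^sub>R f z)) \<partial>lebesgue)"
    unfolding near_potential_def
    by (intro nn_integral_mono) (auto simp: indicator_def ennreal_mult')
  also have "\<dots> < \<infinity>" using assms by (simp add: integrable_iff_bounded)
  finally show ?thesis .
qed

lemma good_if_integrable:
  "integrable lebesgue (\<lambda>z. riesz_kernel \<gamma> (x - z) *\<^sub>R f z) \<Longrightarrow> good x"
  unfolding good_def using near_finite_if_integrable by blast

lemma kdiff_integrable:
  assumes "good x" "good x'"
  shows "integrable lebesgue (kdiff x x')"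
proof -
  obtain m where m: "x \<in> cube 0 (real (Suc m))" "x' \<in> cube 0 (real (Suc m))"
    by (rule common_cube)
  have "(\<integral>\<^sup>+z. ennreal (norm (kdiff x x' z)) \<partial>lebesgue)
    \<le> near 0 (real (Suc m)) x + near 0 (real (Suc m)) x' + ennreal (far_const s) * A"
    using m by (intro kdiff_nn_integral) auto
  also have "\<dots> < \<infinity>"
    using assms m A_finite by (auto simp: good_def ennreal_mult_less_top simp del: of_nat_Suc)
  finally show ?thesis
    by (intro integrableI_bounded) auto
qed

lemma AE_lebesgue_ex:
  fixes P :: "real ^ 'n \<Rightarrow> bool"
  assumes "AE x in lebesgue. P x"
  shows "\<exists>x. P x"
proof (rule ccontr)
  assume "\<nexists>x. P x"
  then have "AE x in (lebesgue :: (real ^ 'n) measure). False" using assms by simp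
  then show False by (simp add: trivial_limit_def eventually_ae_filter null_sets_def top.extremum_unique)
qed

text \<open>A representative of the potential modulo constants is obtained by normalising it to vanish at a
  good base point.\<close>

lemma ex_riesz_mod_const: "\<exists>b. riesz_mod_const \<gamma> f b"
proof -
  obtain x0 where x0: "good x0" using AE_lebesgue_ex[OF AE_good] by blast
  define c where "c = 1 / riesz_const CARD('n) \<gamma>"
  define b where "b x = c *\<^sub>R (LINT z|lebesgue. kdiff x x0 z)" for x
  have "integrable lebesgue (kdiff x x') \<and> b x - b x' = c *\<^sub>R (LINT z|lebesgue. kdiff x x' z)"
    if "good x" "good x'" for x x'
  proof
    have "(LINT z|lebesgue. kdiff x x0 z) - (LINT z|lebesgue. kdiff x' x0 z)
      = (LINT z|lebesgue. kdiff x x0 z - kdiff x' x0 z)"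
      using that x0 by (intro Bochner_Integration.integral_diff[symmetric] kdiff_integrable)
    also have "(\<lambda>z. kdiff x x0 z - kdiff x' x0 z) = kdiff x x'"
      by (simp add: fun_eq_iff algebra_simps)
    finally show "b x - b x' = c *\<^sub>R (LINT z|lebesgue. kdiff x x' z)"
      by (simp add: b_def flip: scaleR_diff_right)
  qed (use that in \<open>rule kdiff_integrable\<close>)
  then have "riesz_mod_const \<gamma> f b"
    unfolding riesz_mod_const_def c_def[symmetric]
    using AE_good by (elim eventually_mono) (use AE_good in \<open>auto elim!: eventually_mono\<close>)
  then show ?thesis by blast
qed

text \<open>If the integral defining \<open>riesz \<gamma> f\<close> converges absolutely at one point, then it does so at every
  good point, since differences converge. Otherwise \<open>riesz \<gamma> f\<close> is the default value \<open>0\<close> everywhere.\<close>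

lemma riesz_dichotomy: "riesz_mod_const \<gamma> f (riesz \<gamma> f) \<or> riesz \<gamma> f = (\<lambda>x. 0)"
proof (cases "\<exists>x. integrable lebesgue (\<lambda>z. riesz_kernel \<gamma> (x - z) *\<^sub>R f z)")
  case True
  then obtain x0 where x0: "integrable lebesgue (\<lambda>z. riesz_kernel \<gamma> (x0 - z) *\<^sub>R f z)" ..
  have "integrable lebesgue (\<lambda>z. riesz_kernel \<gamma> (x - z) *\<^sub>R f z)" if "good x" for x
    using Bochner_Integration.integrable_add[OF kdiff_integrable[OF that good_if_integrable[OF x0]] x0]
    by (simp flip: scaleR_add_left)
  then have "AE x in lebesgue. integrable lebesgue (\<lambda>z. riesz_kernel \<gamma> (x - z) *\<^sub>R f z)"
    using AE_good by (auto elim!: eventually_mono)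
  then show ?thesis using riesz_mod_const_riesz by blast
next
  case False
  then show ?thesis by (auto simp: riesz_def fun_eq_iff not_integrable_integral_eq)
qed

lemma kdiff_integral_measurable [measurable]:
  "(\<lambda>x. LINT z|lebesgue. kdiff x0 x z) \<in> borel_measurable lebesgue"
proof -
  interpret L: sigma_finite_measure "lebesgue :: (real ^ 'n) measure"
    by (rule sigma_finite_lebesgue)
  show ?thesis by measurable
qed

text \<open>The estimate is made for any representative modulo constants, so that it covers both the
  normalised potential and, where it converges, \<open>riesz \<gamma> f\<close> itself.\<close>

lemma riesz_mod_const_bmo:
  assumes b: "riesz_mod_const \<gamma> f b"
  shows "b \<in> bmo" "bmo_norm b \<le> ennreal (riesz_bmo_const \<gamma> TYPE('n)) * A"
proof -
  define c where "c = 1 / riesz_const CARD('n) \<gamma>"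
  define N where "N = near_const \<gamma> TYPE('n)"
  have N: "0 \<le> N" using near_const_nonneg \<gamma> by (simp add: N_def)
  have fc: "0 \<le> far_const s" using far_const_nonneg \<gamma> by blast
  define P where "P x x' \<longleftrightarrow> b x - b x' = c *\<^sub>R (LINT z|lebesgue. kdiff x x' z)
    \<and> integrable lebesgue (kdiff x x')" for x x'
  have P: "AE x in lebesgue. AE x' in lebesgue. P x x'"
    using b unfolding riesz_mod_const_def P_def c_def by (simp add: conj_commute)
  have [measurable]: "b \<in> borel_measurable lebesgue"
  proof -
    obtain x0 where "AE x' in lebesgue. P x0 x'" using AE_lebesgue_ex[OF P] by blast
    then have "AE x in lebesgue. b x0 - c *\<^sub>R (LINT z|lebesgue. kdiff x0 x z) = b x"
    proof eventually_elim
      case (elim x)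
      then have "b x0 - b x = c *\<^sub>R (LINT z|lebesgue. kdiff x0 x z)" by (simp only: P_def)
      then show ?case by (metis diff_diff_eq2 add_diff_cancel_left')
    qed
    then show ?thesis
      by (rule borel_measurable_AE[rotated])
        (intro borel_measurable_diff borel_measurable_const borel_measurable_scaleR kdiff_integral_measurable)
  qed
  define K where "K = ennreal (\<bar>c\<bar> * (2 * N + far_const s)) * A"
  have K: "K < \<infinity>" using A_finite by (simp add: K_def ennreal_mult_less_top)
  have osc: "\<exists>a. (\<integral>\<^sup>+x\<in>cube y l. ennreal (norm (b x - a)) \<partial>lebesgue) \<le> K * ennreal (l ^ CARD('n))"
    if l: "0 < l" for y :: "real ^ 'n" and l
  proof -
    let ?Q = "cube y l"
    define V where "V = l ^ CARD('n)"
    have V: "0 < V" using l by (simp add: V_def)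
    have Q: "emeasure lebesgue ?Q = ennreal V" using l by (simp add: V_def emeasure_cube)
    define M where "M = ennreal N * A"
    have M: "M < \<infinity>" using A_finite by (simp add: M_def ennreal_mult_less_top)
    have u: "(\<integral>\<^sup>+x\<in>?Q. near y l x \<partial>lebesgue) \<le> M * ennreal V"
      using near_integral[OF l, of y] by (simp add: M_def N_def V_def)
    \<comment> \<open>A base point in the cube at which the near potential does not exceed its mean.\<close>
    obtain x1 where x1: "x1 \<in> ?Q" "near y l x1 \<le> M" "AE x' in lebesgue. P x1 x'"
    proof (rule ccontr)
      assume "\<not> thesis"
      with that have none: "\<not> near y l x \<le> M" if "x \<in> ?Q" "AE x' in lebesgue. P x x'" for x
        using \<open>x \<in> ?Q\<close> \<open>AE x' in lebesgue. P x x'\<close> by blast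
      have big: "AE x in lebesgue. x \<in> ?Q \<longrightarrow> M < near y l x"
        using P
      proof eventually_elim
        case (elim x)
        then show ?case using none[of x] by (simp add: not_le)
      qed
      have "(\<integral>\<^sup>+x. M * indicator ?Q x \<partial>lebesgue) < (\<integral>\<^sup>+x. near y l x * indicator ?Q x \<partial>lebesgue)"
      proof (rule nn_integral_less)
        show "(\<integral>\<^sup>+x. M * indicator ?Q x \<partial>lebesgue) \<noteq> \<infinity>"
          using M Q by (simp add: nn_integral_cmult ennreal_mult_eq_top_iff)
        show "AE x in lebesgue. M * indicator ?Q x \<le> near y l x * indicator ?Q x"
          using big by eventually_elim (auto simp: indicator_def)
        show "\<not> (AE x in lebesgue. near y l x * indicator ?Q x \<le> M * indicator ?Q x)"
        proof
          assume "AE x in lebesgue. near y l x * indicator ?Q x \<le> M * indicator ?Q x"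
          with big have "AE x in lebesgue. x \<notin> ?Q"
            by eventually_elim (auto simp: indicator_def)
          then have "emeasure lebesgue ?Q = 0"
            by (subst (asm) AE_iff_null_sets[symmetric]) auto
          then show False using Q V by simp
        qed
      qed auto
      then show False using u Q by (simp add: nn_integral_cmult not_less)
    qed
    have "(\<integral>\<^sup>+x\<in>?Q. ennreal (norm (b x - b x1)) \<partial>lebesgue)
      \<le> (\<integral>\<^sup>+x. ennreal \<bar>c\<bar> * ((M + ennreal (far_const s) * A) * indicator ?Q x
          + near y l x * indicator ?Q x) \<partial>lebesgue)"
    proof (intro nn_integral_mono_AE, use x1(3) in eventually_elim)
      case (elim x)
      show ?case
      proof (cases "x \<in> ?Q")
        case True
        have "ennreal (norm (b x - b x1)) = ennreal \<bar>c\<bar> * ennreal (norm (LINT z|lebesgue. kdiff x1 x z))"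
          using elim by (simp add: P_def norm_minus_commute[of "b x"] ennreal_mult')
        also have "\<dots> \<le> ennreal \<bar>c\<bar> * (\<integral>\<^sup>+z. ennreal (norm (kdiff x1 x z)) \<partial>lebesgue)"
          using elim by (intro mult_left_mono integral_norm_bound_ennreal) (auto simp: P_def)
        also have "\<dots> \<le> ennreal \<bar>c\<bar> * (near y l x1 + near y l x + ennreal (far_const s) * A)"
          using l x1 True by (intro mult_left_mono kdiff_nn_integral) auto
        also have "\<dots> \<le> ennreal \<bar>c\<bar> * (M + near y l x + ennreal (far_const s) * A)"
          using x1 by (intro mult_left_mono add_right_mono) auto
        finally show ?thesis using True by (simp add: ac_simps)
      qed simp
    qed
    also have "\<dots> = ennreal \<bar>c\<bar> * ((M + ennreal (far_const s) * A) * ennreal V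
        + (\<integral>\<^sup>+x\<in>?Q. near y l x \<partial>lebesgue))"
    proof -
      let ?B = "M + ennreal (far_const s) * A"
      have [measurable]: "near y l \<in> borel_measurable lebesgue"
        by (intro near_potential_measurable) measurable
      have B: "(\<integral>\<^sup>+x. ?B * indicator ?Q x \<partial>lebesgue) = ?B * ennreal V"
        by (subst nn_integral_cmult_indicator) (simp_all only: Q sets_cube)
      have "(\<integral>\<^sup>+x. ennreal \<bar>c\<bar> * (?B * indicator ?Q x + near y l x * indicator ?Q x) \<partial>lebesgue)
        = ennreal \<bar>c\<bar> * (\<integral>\<^sup>+x. ?B * indicator ?Q x + near y l x * indicator ?Q x \<partial>lebesgue)"
        by (intro nn_integral_cmult) measurable
      also have "(\<integral>\<^sup>+x. ?B * indicator ?Q x + near y l x * indicator ?Q x \<partial>lebesgue)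
        = (\<integral>\<^sup>+x. ?B * indicator ?Q x \<partial>lebesgue) + (\<integral>\<^sup>+x\<in>?Q. near y l x \<partial>lebesgue)"
        by (intro nn_integral_add) measurable
      finally show ?thesis unfolding B .
    qed
    also have "\<dots> \<le> ennreal \<bar>c\<bar> * ((M + ennreal (far_const s) * A) * ennreal V + M * ennreal V)"
      by (intro mult_left_mono add_left_mono u) auto
    also have "\<dots> = ennreal \<bar>c\<bar> * ((ennreal N + ennreal N + ennreal (far_const s)) * A) * ennreal V"
      unfolding M_def by (simp add: distrib_right distrib_left ac_simps)
    also have "\<dots> = K * ennreal V"
    proof -
      have "ennreal N + ennreal N + ennreal (far_const s) = ennreal (2 * N + far_const s)"
        using N fc by (simp add: ennreal_plus[symmetric] del: ennreal_plus)
      then show ?thesis using N fc by (simp add: K_def ennreal_mult' mult.assoc)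
    qed
    finally show ?thesis unfolding V_def by blast
  qed
  have "emean (cube y l) (\<lambda>x. ennreal (norm (b x - mean (cube y l) b))) \<le> 2 * K"
    and int: "set_integrable lebesgue (cube y l) b" if l: "0 < l" for y l
  proof -
    obtain a where "(\<integral>\<^sup>+x\<in>cube y l. ennreal (norm (b x - a)) \<partial>lebesgue) \<le> K * ennreal (l ^ CARD('n))"
      using osc[OF l] by blast
    from mean_oscillation_le[OF \<open>b \<in> _\<close> l K this]
    show "emean (cube y l) (\<lambda>x. ennreal (norm (b x - mean (cube y l) b))) \<le> 2 * K"
      "set_integrable lebesgue (cube y l) b" by blast+
  qed
  then have "bmo_norm b \<le> 2 * K"
    unfolding bmo_norm_def by (intro SUP_least) auto
  also have "2 * K = ennreal (riesz_bmo_const \<gamma> TYPE('n)) * A"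
    unfolding K_def riesz_bmo_const_def c_def N_def using N fc \<gamma>
    by (subst (2) ennreal_mult') (auto simp: mult.assoc)
  finally show norm: "bmo_norm b \<le> ennreal (riesz_bmo_const \<gamma> TYPE('n)) * A" .
  have "loc_integrable b"
    unfolding loc_integrable_def
  proof (intro allI impI)
    fix K :: "(real ^ 'n) set"
    assume "compact K"
    then obtain l where l: "0 < l" "K \<subseteq> cube 0 l" by (rule compact_subset_cube)
    have "K \<in> sets lborel" using \<open>compact K\<close> by (simp add: borel_compact)
    then have "K \<in> sets lebesgue" by (rule sets_completionI_sets)
    then show "set_integrable lebesgue K b"
      by (rule set_integrable_subset[OF int[OF l(1)] _ l(2)])
  qed
  moreover have "bmo_norm b < \<infinity>"
    using norm A_finite by (auto simp: ennreal_mult_less_top elim!: le_less_trans)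
  ultimately show "b \<in> bmo" by (simp add: bmo_def)
qed

lemma bmo_zero: "(\<lambda>x. 0) \<in> bmo" "bmo_norm (\<lambda>x. 0) = 0"
  by (auto simp: bmo_def bmo_norm_def loc_integrable_def set_integrable_def mean_def emean_def set_lebesgue_integral_def)

lemma riesz_bmo: "riesz \<gamma> f \<in> bmo" "bmo_norm (riesz \<gamma> f) \<le> ennreal (riesz_bmo_const \<gamma> TYPE('n)) * A"
  using riesz_dichotomy riesz_mod_const_bmo by (auto simp: bmo_zero)

end

theorem theorem2p5:
  fixes w \<nu> :: "real ^ 'n \<Rightarrow> real" and \<gamma> p q r \<kappa> :: real
  assumes "0 < \<gamma>" "\<gamma> < real CARD('n)"
    and "1 < p" "p < q"
    and "weight w" "weight \<nu>"
    and "1 < r"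
    and "\<exists>C::real. \<forall>y l. l > 0 \<longrightarrow>
           emean (cube y l) (neg_power \<nu> (conj_exp p / p)) < \<infinity> \<and>
           ennreal (measure lebesgue (cube y l) powr (\<gamma> / real CARD('n) + 1 / q - 1 / p))
             * epow (emean (cube y l) (\<lambda>x. ennreal (w x powr r))) (1 / (r * q))
             * epow (emean (cube y l) (neg_power \<nu> (conj_exp p / p))) (1 / conj_exp p)
           \<le> ennreal C"
    and "\<kappa> = p / q"
    and "doubling w"
  shows "\<exists>C::real. \<forall>f \<in> morrey_space p \<kappa> \<nu> w.
           (riesz \<gamma> f \<in> bmo \<and> bmo_norm (riesz \<gamma> f) \<le> ennreal C * morrey_norm p \<kappa> \<nu> w f) \<and>
           (\<exists>b \<in> bmo. riesz_mod_const \<gamma> f b \<and> bmo_norm b \<le> ennreal C * morrey_norm p \<kappa> \<nu> w f)"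
proof -
  obtain C :: real where
    fin: "\<And>y l. 0 < l \<Longrightarrow> emean (cube y l) (neg_power \<nu> (conj_exp p / p)) < \<infinity>" and
    C: "\<And>y l. 0 < l \<Longrightarrow>
      ennreal (measure lebesgue (cube y l) powr (\<gamma> / real CARD('n) + 1 / q - 1 / p))
        * epow (emean (cube y l) (\<lambda>x. ennreal (w x powr r))) (1 / (r * q))
        * epow (emean (cube y l) (neg_power \<nu> (conj_exp p / p))) (1 / conj_exp p) \<le> ennreal C"
    using assms(8) by blast
  define s where "s = real CARD('n) - \<gamma>"
  define B where "B = riesz_bmo_const \<gamma> TYPE('n)"
  have "0 \<le> B" unfolding B_def using assms(1,2) by (intro riesz_bmo_const_nonneg) auto
  show ?thesis
  proof (intro exI[of _ "B * C"] ballI)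
    fix f assume f: "f \<in> morrey_space p \<kappa> \<nu> w"
    define A where "A = ennreal C * morrey_norm p \<kappa> \<nu> w f"
    interpret L1_morrey f A \<gamma> s
    proof
      show "f \<in> borel_measurable lebesgue" "A < \<infinity>"
        using f by (auto simp: morrey_space_def A_def ennreal_mult_less_top)
      show "(\<integral>\<^sup>+z\<in>cube y l. ennreal (norm (f z)) \<partial>lebesgue) \<le> A * ennreal (l powr s)"
        if "0 < l" for y l
        using morrey_space_L1_bound[OF assms(3,4,7,5,6) that fin[OF that] C[OF that]] f assms(9)
        by (simp add: A_def s_def)
    qed (use assms in \<open>auto simp: s_def\<close>)
    have *: "ennreal (riesz_bmo_const \<gamma> TYPE('n)) * A = ennreal (B * C) * morrey_norm p \<kappa> \<nu> w f"
      unfolding B_def[symmetric] A_def using \<open>0 \<le> B\<close> by (simp add: ennreal_mult' mult.assoc)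
    show "(riesz \<gamma> f \<in> bmo \<and> bmo_norm (riesz \<gamma> f) \<le> ennreal (B * C) * morrey_norm p \<kappa> \<nu> w f) \<and>
      (\<exists>b\<in>bmo. riesz_mod_const \<gamma> f b \<and> bmo_norm b \<le> ennreal (B * C) * morrey_norm p \<kappa> \<nu> w f)"
      using riesz_bmo ex_riesz_mod_const riesz_mod_const_bmo unfolding * by blast
  qed
qed

end
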